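(* There is a distributed algorithm in the CONGEST model that computes a $2$-approximation for the unweighted minimum $2$-edge-connected spanning subgraph problem (unweighted 2-ECSS) in $O(D)$ rounds, where $D$ is the diameter of the input graph.
   Context: CONGEST model: the network is an undirected connected $n$-vertex graph $G$; synchronous rounds, each vertex sends an $O(\log n)$-bit message to each neighbour per round. Unweighted 2-ECSS: given a $2$-edge-connected graph $G$ (the network), find a spanning subgraph $H$ of $G$ that is $2$-edge-connected (remains connected after removing any single edge) with the minimum number of edges; at the end each vertex knows which incident edges are in $H$. A $2$-approximation outputs such an $H$ with at most twice the optimum number of edges. *)

theory Defs
  imports Complex_Main
begin

section \<open>Finite simple graphs\<close>

definition simple_graph :: "'a set \<Rightarrow> 'a set set \<Rightarrow> bool" where
  "simple_graph V E \<longleftrightarrow> finite V \<and> V \<noteq> {} \<and> (\<forall>e\<in>E. e \<subseteq> V \<and> card e = 2)"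

definition adj :: "'a set set \<Rightarrow> ('a \<times> 'a) set" where
  "adj E = {(u, v). {u, v} \<in> E}"

definition neighbours :: "'a set set \<Rightarrow> 'a \<Rightarrow> 'a set" where
  "neighbours E v = {u. {v, u} \<in> E}"

definition graph_connected :: "'a set \<Rightarrow> 'a set set \<Rightarrow> bool" where
  "graph_connected V E \<longleftrightarrow> (\<forall>u\<in>V. \<forall>v\<in>V. (u, v) \<in> (adj E)\<^sup>*)"

definition two_edge_connected :: "'a set \<Rightarrow> 'a set set \<Rightarrow> bool" where
  "two_edge_connected V E \<longleftrightarrow>
     graph_connected V E \<and> (\<forall>e\<in>E. graph_connected V (E - {e}))"

text \<open>Distance and diameter are only meaningful for connected graphs.\<close>

definition graph_dist :: "'a set set \<Rightarrow> 'a \<Rightarrow> 'a \<Rightarrow> nat" where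
  "graph_dist E u v = (LEAST k. (u, v) \<in> adj E ^^ k)"

definition graph_diameter :: "'a set \<Rightarrow> 'a set set \<Rightarrow> nat" where
  "graph_diameter V E = Max {graph_dist E u v |u v. u \<in> V \<and> v \<in> V}"

section \<open>Unweighted 2-ECSS\<close>

text \<open>A spanning subgraph of \<open>(V, E)\<close> is given by its edge set \<open>H\<close>.\<close>

definition is_2ecss :: "'a set \<Rightarrow> 'a set set \<Rightarrow> 'a set set \<Rightarrow> bool" where
  "is_2ecss V E H \<longleftrightarrow> H \<subseteq> E \<and> two_edge_connected V H"

definition opt_2ecss :: "'a set \<Rightarrow> 'a set set \<Rightarrow> nat" where
  "opt_2ecss V E = Min {card H |H. is_2ecss V E H}"

definition two_approx_2ecss :: "'a set \<Rightarrow> 'a set set \<Rightarrow> 'a set set \<Rightarrow> bool" where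
  "two_approx_2ecss V E H \<longleftrightarrow> is_2ecss V E H \<and> card H \<le> 2 * opt_2ecss V E"

section \<open>The CONGEST model\<close>

text \<open>
  Vertices are identified with their unique identifiers, which are natural numbers of
  \<open>O(log n)\<close> bits, i.e. below \<open>n ^ c\<close> for a constant \<open>c\<close>, where \<open>n = card V\<close>.
\<close>

definition congest_network :: "nat \<Rightarrow> nat set \<Rightarrow> nat set set \<Rightarrow> bool" where
  "congest_network c V E \<longleftrightarrow>
     simple_graph V E \<and> graph_connected V E \<and> (\<forall>v\<in>V. v < card V ^ c)"

text \<open>
  A deterministic algorithm, run by every vertex, with local states of type \<open>'s\<close>:
  \<^item> \<open>init v N\<close> is the initial state of the vertex with identifier \<open>v\<close> whose
    neighbours have the identifiers \<open>N\<close>; a vertex knows nothing else about the network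
    (in particular neither \<open>n\<close> nor the diameter);
  \<^item> \<open>send s u\<close> is the bit string sent in state \<open>s\<close> to neighbour \<open>u\<close>
    (\<open>None\<close>: no message);
  \<^item> \<open>receive s M\<close> is the state after receiving the messages \<open>M\<close>, indexed by sender;
  \<^item> \<open>result s = Some N\<close> means that a vertex in state \<open>s\<close> has halted with output \<open>N\<close>.

  Local computation is unrestricted. Taking \<open>'s = nat\<close> loses no generality: identifiers,
  finite neighbourhoods and finite message histories form a countable set, so a vertex can
  code its whole history as a number.
\<close>

record 's congest_algorithm =
  init :: "nat \<Rightarrow> nat set \<Rightarrow> 's"
  send :: "'s \<Rightarrow> nat \<Rightarrow> bool list option"
  receive :: "'s \<Rightarrow> (nat \<Rightarrow> bool list option) \<Rightarrow> 's"
  result :: "'s \<Rightarrow> nat set option"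

text \<open>\<open>message A E \<sigma> u v\<close> is the message from \<open>u\<close> to \<open>v\<close> when the local states are
  \<open>\<sigma>\<close>. Halted vertices send nothing.\<close>

definition message ::
  "'s congest_algorithm \<Rightarrow> nat set set \<Rightarrow> (nat \<Rightarrow> 's) \<Rightarrow> nat \<Rightarrow> nat \<Rightarrow> bool list option" where
  "message A E \<sigma> u v =
     (if {u, v} \<in> E \<and> result A (\<sigma> u) = None then send A (\<sigma> u) v else None)"

text \<open>Local states after \<open>t\<close> synchronous rounds. Halting, and hence the output, is
  irrevocable.\<close>

primrec run :: "'s congest_algorithm \<Rightarrow> nat set set \<Rightarrow> nat \<Rightarrow> nat \<Rightarrow> 's" where
  "run A E 0 = (\<lambda>v. init A v (neighbours E v))"
| "run A E (Suc t) = (\<lambda>v.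
     if result A (run A E t v) = None
     then receive A (run A E t v) (\<lambda>u. message A E (run A E t) u v)
     else run A E t v)"

definition bandwidth_at_most ::
  "'s congest_algorithm \<Rightarrow> nat set set \<Rightarrow> real \<Rightarrow> bool" where
  "bandwidth_at_most A E B \<longleftrightarrow>
     (\<forall>t u v m. message A E (run A E t) u v = Some m \<longrightarrow> real (length m) \<le> B)"

text \<open>After \<open>T\<close> rounds all vertices have halted, and each one outputs its incident edges
  in \<open>H\<close>, represented by their other endpoints.\<close>

definition computes_edges_within ::
  "'s congest_algorithm \<Rightarrow> nat set \<Rightarrow> nat set set \<Rightarrow> nat \<Rightarrow> nat set set \<Rightarrow> bool" where
  "computes_edges_within A V E T H \<longleftrightarrow>
     (\<forall>v\<in>V. result A (run A E T v) = Some (neighbours H v))"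

end

theory Submission
  imports Defs "HOL-Library.FSet" "HOL-Library.Nat_Bijection" "HOL-Library.Product_Lexorder"
begin

text \<open>
  A 2-edge-connected graph on \<open>n \<ge> 2\<close> vertices has at least \<open>n\<close> edges, so a BFS tree together
  with one covering edge per tree edge is a 2-approximation.

  The vertices flood the minimal identifier \<open>L\<close>, the distance \<open>d\<close> to its owner, and the maximal
  value \<open>M\<close> that any vertex ever had for \<open>d\<close>. The condition \<open>3 M + 2 \<le> t\<close> on the round number
  \<open>t\<close> first holds at all vertices in the same round, and then \<open>L\<close>, \<open>d\<close> and \<open>M\<close> are final. So
  the vertices know a BFS tree of height at most \<open>M\<close>, share a clock, and run three phases of
  \<open>M + 1\<close> rounds each: every vertex learns its ancestors and those of its neighbours, one ancestor
  per round; a convergecast selects for every \<open>v\<close> a non-tree edge at the subtree of \<open>v\<close> whose ends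
  have the fewest common ancestors, which leaves the subtree since some non-tree edge does; the
  selected edges are handed down the tree to their ends.
\<close>

section \<open>Edge counts and spanning trees\<close>

lemma adj_iff [simp]: "(u, v) \<in> adj E \<longleftrightarrow> {u, v} \<in> E"
  by (simp add: adj_def)

lemma sym_adj: "sym (adj E)"
  by (auto simp: sym_def insert_commute)

lemma adj_rtrancl_sym: "(u, v) \<in> (adj E)\<^sup>* \<Longrightarrow> (v, u) \<in> (adj E)\<^sup>*"
  using sym_adj sym_rtrancl symD by metis

lemma adj_relpow_sym: "(u, v) \<in> adj E ^^ k \<Longrightarrow> (v, u) \<in> adj E ^^ k"
proof (induction k arbitrary: v)
  case (Suc k)
  then obtain w where "(u, w) \<in> adj E ^^ k" "(w, v) \<in> adj E"
    by (auto elim: relpow_Suc_E)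
  then show ?case
    using Suc.IH by (metis relpow_Suc_I2 sym_adj symD)
qed simp

lemma adj_mono: "E \<subseteq> F \<Longrightarrow> adj E \<subseteq> adj F"
  by (auto simp: adj_def)

lemma graph_connected_mono: "graph_connected V E \<Longrightarrow> E \<subseteq> F \<Longrightarrow> graph_connected V F"
  unfolding graph_connected_def using rtrancl_mono[OF adj_mono] by blast

lemma graph_connected_via_root:
  assumes "\<And>v. v \<in> V \<Longrightarrow> (v, r) \<in> (adj E)\<^sup>*"
  shows "graph_connected V E"
  unfolding graph_connected_def
proof (intro ballI)
  fix u v assume "u \<in> V" "v \<in> V"
  show "(u, v) \<in> (adj E)\<^sup>*"
    by (rule rtrancl_trans[OF assms[OF \<open>u \<in> V\<close>] adj_rtrancl_sym[OF assms[OF \<open>v \<in> V\<close>]]])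
qed

lemma rtrancl_leaves_set:
  assumes "(u, v) \<in> R\<^sup>*" "u \<in> S" "v \<notin> S"
  obtains a b where "(a, b) \<in> R" "a \<in> S" "b \<notin> S"
proof -
  have "\<exists>a b. (a, b) \<in> R \<and> a \<in> S \<and> b \<notin> S"
    using assms by (induction rule: rtrancl_induct) blast+
  then show ?thesis using that by blast
qed

lemma simple_graph_edgeD:
  assumes "simple_graph V E" "{u, v} \<in> E"
  shows "u \<in> V" "v \<in> V" "u \<noteq> v"
proof -
  have "{u, v} \<subseteq> V" "card {u, v} = 2" using assms unfolding simple_graph_def by blast+
  then show "u \<in> V" "v \<in> V" "u \<noteq> v" by auto
qed

lemma simple_graph_finite: "simple_graph V E \<Longrightarrow> finite V \<and> finite E"
  unfolding simple_graph_def by (metis finite_Pow_iff finite_subset Pow_iff subsetI)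

lemma simple_graph_subset: "simple_graph V E \<Longrightarrow> H \<subseteq> E \<Longrightarrow> simple_graph V H"
  unfolding simple_graph_def by blast

lemma neighbours_subset: "simple_graph V E \<Longrightarrow> neighbours E v \<subseteq> V - {v}"
  unfolding neighbours_def by (auto dest: simple_graph_edgeD)

lemma finite_neighbours: "simple_graph V E \<Longrightarrow> finite (neighbours E v)"
  by (meson finite_Diff finite_subset neighbours_subset simple_graph_finite)

section \<open>Lower bound on the size of 2-edge-connected subgraphs\<close>

lemma connected_incident_edge:
  assumes "simple_graph V E" "graph_connected V E" "card V \<ge> 2" "v \<in> V"
  obtains e where "e \<in> E" "v \<in> e"
proof -
  have "V \<noteq> {v}" using assms(3) by auto
  then obtain w where "w \<in> V" "w \<noteq> v" using assms(4) by blast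
  then have "(v, w) \<in> (adj E)\<^sup>*" using assms(2,4) by (auto simp: graph_connected_def)
  then show ?thesis
    using \<open>w \<noteq> v\<close> that by (metis adj_iff converse_rtranclE insertI1)
qed

text \<open>All degrees are at least two: after removal of one edge \<open>e\<close> at
  \<open>v\<close> the graph is still connected, so another edge is left at \<open>v\<close>.
  Counting the incidences of vertices and edges in two ways then gives the bound.\<close>

lemma two_edge_connected_card_ge:
  assumes "simple_graph V H" "two_edge_connected V H" "card V \<ge> 2"
  shows "card V \<le> card H"
proof -
  have fin: "finite V" "finite H" using assms(1) simple_graph_finite by auto
  have deg: "2 \<le> card {e \<in> H. v \<in> e}" if v: "v \<in> V" for v
  proof -
    obtain e where e: "e \<in> H" "v \<in> e"
      using connected_incident_edge[OF assms(1) _ assms(3) v] assms(2)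
      by (auto simp: two_edge_connected_def)
    moreover obtain f where f: "f \<in> H - {e}" "v \<in> f"
      using connected_incident_edge[OF simple_graph_subset[OF assms(1)] _ assms(3) v, of "H - {e}"]
        assms(2) e by (auto simp: two_edge_connected_def)
    ultimately have "e \<noteq> f" "{e, f} \<subseteq> {e \<in> H. v \<in> e}" by blast+
    moreover from \<open>e \<noteq> f\<close> have "card {e, f} = 2" by simp
    moreover have "finite {e \<in> H. v \<in> e}" using fin by simp
    ultimately show ?thesis using card_mono by metis
  qed
  have "2 * card V = (\<Sum>v\<in>V. 2)" by simp
  also have "\<dots> \<le> (\<Sum>v\<in>V. card {e \<in> H. v \<in> e})" by (rule sum_mono) (rule deg)
  also have "\<dots> = (\<Sum>v\<in>V. \<Sum>e\<in>H. if v \<in> e then 1 else 0)"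
    using fin by (simp add: sum.If_cases Int_def)
  also have "\<dots> = (\<Sum>e\<in>H. \<Sum>v\<in>V. if v \<in> e then 1 else 0)" by (rule sum.swap)
  also have "\<dots> = (\<Sum>e\<in>H. 2)"
  proof (rule sum.cong)
    fix e assume "e \<in> H"
    then have "e \<subseteq> V" "card e = 2" using assms(1) by (auto simp: simple_graph_def)
    then have "V \<inter> e = e" by blast
    then show "(\<Sum>v\<in>V. if v \<in> e then 1 else (0::nat)) = 2"
      using fin \<open>card e = 2\<close> by (simp add: sum.If_cases)
  qed simp
  finally show ?thesis by simp
qed

lemma opt_2ecss_ge:
  assumes "simple_graph V E" "two_edge_connected V E" "card V \<ge> 2"
  shows "card V \<le> opt_2ecss V E"
proof -
  have *: "{card H |H. is_2ecss V E H} = card ` {H. is_2ecss V E H}" by auto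
  have "finite {H. is_2ecss V E H}"
    using simple_graph_finite[OF assms(1)]
    by (auto intro: finite_subset[of _ "Pow E"] simp: is_2ecss_def)
  moreover have "is_2ecss V E E" using assms(2) by (simp add: is_2ecss_def)
  ultimately have "opt_2ecss V E \<in> card ` {H. is_2ecss V E H}"
    unfolding opt_2ecss_def * by (intro Min_in) auto
  then obtain H where "opt_2ecss V E = card H" "H \<subseteq> E" "two_edge_connected V H"
    by (auto simp: is_2ecss_def)
  then show ?thesis
    using two_edge_connected_card_ge simple_graph_subset assms(1,3) by metis
qed

section \<open>Ancestors under a parent map\<close>

definition ancestors :: "('a \<Rightarrow> 'a) \<Rightarrow> 'a \<Rightarrow> 'a set" where
  "ancestors p v = range (\<lambda>i. (p ^^ i) v)"

lemma ancestors_refl [simp]: "v \<in> ancestors p v"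
  unfolding ancestors_def by (rule range_eqI[where x = 0]) simp

lemma ancestors_step [simp]: "p v \<in> ancestors p v"
  unfolding ancestors_def by (rule range_eqI[where x = 1]) simp

lemma funpow_funpow: "(p ^^ i) ((p ^^ j) x) = (p ^^ (i + j)) x"
  by (simp add: funpow_add)

lemma ancestors_trans: "x \<in> ancestors p y \<Longrightarrow> y \<in> ancestors p z \<Longrightarrow> x \<in> ancestors p z"
  unfolding ancestors_def by (auto simp: funpow_funpow)

lemma ancestors_unfold: "ancestors p v = insert v (ancestors p (p v))"
proof -
  have "\<exists>j. (p ^^ i) v = (p ^^ j) (p v)" if "(p ^^ i) v \<noteq> v" for i
    using that by (cases i) (auto simp: funpow_swap1)
  then have "ancestors p v \<subseteq> insert v (ancestors p (p v))"
    by (auto simp: ancestors_def)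
  then show ?thesis using ancestors_trans[OF _ ancestors_step, of _ p v] by auto
qed

text \<open>Both vertices lie on the one chain that climbs from \<open>w\<close>; the one reached
  after more steps is an ancestor of the other.\<close>

lemma ancestors_linear:
  assumes "x \<in> ancestors p w" "v \<in> ancestors p w"
  shows "x \<in> ancestors p v \<or> v \<in> ancestors p x"
proof -
  obtain i k where ik: "x = (p ^^ i) w" "v = (p ^^ k) w" using assms by (auto simp: ancestors_def)
  show ?thesis
  proof (cases "i \<le> k")
    case True
    then have "v = (p ^^ (k - i)) x" using ik by (simp add: funpow_funpow)
    then show ?thesis by (auto simp: ancestors_def)
  next
    case False
    then have "x = (p ^^ (i - k)) v" using ik by (simp add: funpow_funpow)
    then show ?thesis by (auto simp: ancestors_def)
  qed
qed

section \<open>Rooted spanning trees of bounded height\<close>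

locale spanning_tree =
  fixes V :: "'a set" and E :: "'a set set" and r :: 'a and p :: "'a \<Rightarrow> 'a"
    and \<delta> :: "'a \<Rightarrow> nat" and m :: nat
  assumes graph: "simple_graph V E"
    and root: "r \<in> V" "p r = r"
    and parent_edge: "\<And>v. v \<in> V \<Longrightarrow> v \<noteq> r \<Longrightarrow> {v, p v} \<in> E"
    and depth_parent: "\<And>v. v \<in> V \<Longrightarrow> v \<noteq> r \<Longrightarrow> \<delta> v = Suc (\<delta> (p v))"
    and depth_le: "\<And>v. v \<in> V \<Longrightarrow> \<delta> v \<le> m"
begin

lemma finV: "finite V"
  using simple_graph_finite[OF graph] by auto

lemma parent_in: "v \<in> V \<Longrightarrow> p v \<in> V"
  using parent_edge root simple_graph_edgeD[OF graph] by metis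

lemma iter_parent_in: "v \<in> V \<Longrightarrow> (p ^^ i) v \<in> V"
  by (induction i) (auto intro: parent_in)

lemma iter_parent_root [simp]: "(p ^^ i) r = r"
  by (induction i) (auto simp: root)

lemma iter_parent_depth: "v \<in> V \<Longrightarrow> \<delta> v \<le> j \<Longrightarrow> (p ^^ j) v = r"
proof (induction j arbitrary: v)
  case (Suc j)
  show ?case
  proof (cases "v = r")
    case False
    then have "(p ^^ j) (p v) = r" using Suc depth_parent parent_in by auto
    then show ?thesis by (simp add: funpow_swap1)
  qed (simp del: funpow.simps)
qed (use depth_parent in fastforce)

text \<open>A chain reaches the root within \<open>m\<close> steps and stays there. So
  \<open>m + 1\<close> rounds with one ancestor each collect all of them.\<close>

lemma ancestors_bounded: "v \<in> V \<Longrightarrow> ancestors p v = (\<lambda>i. (p ^^ i) v) ` {..m}"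
proof -
  assume v: "v \<in> V"
  have "(p ^^ i) v \<in> (\<lambda>i. (p ^^ i) v) ` {..m}" for i
  proof (cases "i \<le> m")
    case False
    then have "(p ^^ i) v = (p ^^ m) v"
      using iter_parent_depth[OF v] depth_le[OF v] by simp
    then show ?thesis by auto
  qed auto
  then show ?thesis by (auto simp: ancestors_def)
qed

lemma ancestors_subset: "v \<in> V \<Longrightarrow> ancestors p v \<subseteq> V"
  by (auto simp: ancestors_def iter_parent_in)

lemma finite_ancestors: "v \<in> V \<Longrightarrow> finite (ancestors p v)"
  using ancestors_subset finV finite_subset by blast

lemma ancestors_root [simp]: "ancestors p r = {r}"
  by (auto simp: ancestors_def)

lemma parent_edge_eq:
  assumes "v \<in> V" "v \<noteq> r" "y \<in> V" "y \<noteq> r" "{y, p y} = {v, p v}"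
  shows "y = v"
proof (rule ccontr)
  assume "y \<noteq> v"
  with assms(5) have "y = p v" "p y = v" by (auto simp: doubleton_eq_iff)
  then show False using depth_parent[of v] depth_parent[of y] assms by simp
qed

text \<open>The number of common ancestors of \<open>w\<close> and \<open>u\<close> is one more than the depth of their
  lowest common ancestor. Hence an edge leaves the subtree of an ancestor \<open>v\<close> of \<open>w\<close> iff its
  ends have fewer common ancestors than \<open>v\<close> has ancestors.\<close>

lemma card_common_ancestors_less_iff:
  assumes "w \<in> V" "u \<in> V" "v \<in> ancestors p w"
  shows "card (ancestors p w \<inter> ancestors p u) < card (ancestors p v) \<longleftrightarrow> v \<notin> ancestors p u"
proof -
  have v: "v \<in> V" using assms ancestors_subset by blast
  show ?thesis
  proof
    assume "v \<notin> ancestors p u"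
    then have "ancestors p w \<inter> ancestors p u \<subset> ancestors p v"
      using ancestors_linear[OF _ assms(3)] ancestors_trans[of v p _ u] ancestors_refl[of v p] by blast
    then show "card (ancestors p w \<inter> ancestors p u) < card (ancestors p v)"
      using psubset_card_mono finite_ancestors v by blast
  next
    assume less: "card (ancestors p w \<inter> ancestors p u) < card (ancestors p v)"
    show "v \<notin> ancestors p u"
    proof
      assume u: "v \<in> ancestors p u"
      have "ancestors p v \<subseteq> ancestors p w \<inter> ancestors p u"
        using ancestors_trans[OF _ u] ancestors_trans[OF _ assms(3)] by auto
      then have "card (ancestors p v) \<le> card (ancestors p w \<inter> ancestors p u)"
        by (intro card_mono finite_Int disjI1 finite_ancestors assms(1))
      then show False using less by simp
    qed
  qed
qed

section \<open>Tree edges and their covering by non-tree edges\<close>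

definition tree_edges :: "'a set set" where
  "tree_edges = (\<lambda>v. {v, p v}) ` (V - {r})"

lemma tree_edges_subset: "tree_edges \<subseteq> E"
  using parent_edge by (auto simp: tree_edges_def)

text \<open>A test on parent pointers alone, which both ends of an edge can perform. The hypothesis
  rules out the loop at the root, which is its own parent.\<close>

lemma tree_edges_iff:
  assumes "{u, v} \<in> E"
  shows "{u, v} \<in> tree_edges \<longleftrightarrow> p u = v \<or> p v = u"
proof -
  have "u \<in> V" "v \<in> V" "u \<noteq> v" using simple_graph_edgeD[OF graph assms] by auto
  then have "v \<noteq> r" if "p v = u" using root that by auto
  moreover have "u \<noteq> r" if "p u = v" using root that \<open>u \<noteq> v\<close> by auto
  moreover have "{u, v} \<in> tree_edges \<longleftrightarrow> (\<exists>x\<in>V - {r}. u = x \<and> v = p x \<or> u = p x \<and> v = x)"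
    unfolding tree_edges_def image_iff doubleton_eq_iff ..
  ultimately show ?thesis using \<open>u \<in> V\<close> \<open>v \<in> V\<close> by blast
qed

lemma tree_path_root:
  assumes "x \<in> V"
  shows "(x, r) \<in> (adj tree_edges)\<^sup>*"
proof -
  have "(p ^^ i) x = r \<Longrightarrow> x \<in> V \<Longrightarrow> (x, r) \<in> (adj tree_edges)\<^sup>*" for i
  proof (induction i arbitrary: x)
    case (Suc i)
    have *: "(p x, r) \<in> (adj tree_edges)\<^sup>*"
      using Suc parent_in by (simp add: funpow_swap1)
    show ?case
    proof (cases "x = r")
      case False
      then have "(x, p x) \<in> adj tree_edges" using Suc.prems by (auto simp: tree_edges_def)
      then show ?thesis using * by (rule converse_rtrancl_into_rtrancl)
    qed simp
  qed simp
  then show ?thesis using iter_parent_depth[OF assms order_refl] assms by blast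
qed

text \<open>The climb from \<open>x\<close> to \<open>v\<close> uses parent edges of vertices other
  than \<open>v\<close>, and by \<open>parent_edge_eq\<close> none of these is
  \<open>{v, p v}\<close>.\<close>

lemma subtree_path:
  assumes "v \<in> V" "v \<noteq> r" "x \<in> V" "v \<in> ancestors p x"
  shows "(x, v) \<in> (adj (tree_edges - {{v, p v}}))\<^sup>*"
proof -
  have "(p ^^ i) x = v \<Longrightarrow> x \<in> V \<Longrightarrow> (x, v) \<in> (adj (tree_edges - {{v, p v}}))\<^sup>*" for i
  proof (induction i arbitrary: x)
    case (Suc i)
    have *: "(p x, v) \<in> (adj (tree_edges - {{v, p v}}))\<^sup>*"
      using Suc parent_in by (simp add: funpow_swap1)
    show ?case
    proof (cases "x = r \<or> x = v")
      case False
      then have "(x, p x) \<in> adj (tree_edges - {{v, p v}})"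
        using Suc.prems parent_edge_eq[OF assms(1,2), of x] by (auto simp: tree_edges_def)
      then show ?thesis using * by (rule converse_rtrancl_into_rtrancl)
    next
      case True
      then show ?thesis using * root by auto
    qed
  qed simp
  then show ?thesis using assms by (auto simp: ancestors_def)
qed

lemma outside_subtree_path:
  assumes "v \<in> V" "v \<noteq> r" "x \<in> V" "v \<notin> ancestors p x"
  shows "(x, r) \<in> (adj (tree_edges - {{v, p v}}))\<^sup>*"
proof -
  have "(p ^^ i) x = r \<Longrightarrow> x \<in> V \<Longrightarrow> v \<notin> ancestors p x \<Longrightarrow>
      (x, r) \<in> (adj (tree_edges - {{v, p v}}))\<^sup>*" for i
  proof (induction i arbitrary: x)
    case (Suc i)
    have "v \<notin> ancestors p (p x)" using Suc.prems(3) ancestors_unfold[of p x] by auto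
    then have *: "(p x, r) \<in> (adj (tree_edges - {{v, p v}}))\<^sup>*"
      using Suc parent_in by (simp add: funpow_swap1)
    show ?case
    proof (cases "x = r")
      case False
      then have "(x, p x) \<in> adj (tree_edges - {{v, p v}})"
        using Suc.prems parent_edge_eq[OF assms(1,2), of x] ancestors_refl[of v p]
        by (auto simp: tree_edges_def)
      then show ?thesis using * by (rule converse_rtrancl_into_rtrancl)
    qed simp
  qed simp
  then show ?thesis using iter_parent_depth[OF assms(3) order_refl] assms by blast
qed

text \<open>Without a non-tree edge the tree still connects everything. Without
  \<open>{v, p v}\<close> the covering edge is a detour: from the subtree to \<open>v\<close>, down
  to \<open>w\<close>, across to \<open>u\<close>, and up to \<open>r\<close> outside the
  subtree.\<close>

lemma two_edge_connected_augmented: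
  assumes "tree_edges \<subseteq> H"
    and cover: "\<And>v. v \<in> V \<Longrightarrow> v \<noteq> r \<Longrightarrow>
      \<exists>w\<in>V. \<exists>u\<in>V. {w, u} \<in> H - {{v, p v}} \<and> v \<in> ancestors p w \<and> v \<notin> ancestors p u"
  shows "two_edge_connected V H"
proof -
  have conn: "graph_connected V tree_edges"
    using graph_connected_via_root tree_path_root by metis
  have "graph_connected V (H - {e})" if "e \<in> H" for e
  proof (cases "e \<in> tree_edges")
    case False
    then show ?thesis using conn graph_connected_mono assms(1) by (metis Diff_empty subset_Diff_insert)
  next
    case True
    then obtain v where v: "v \<in> V" "v \<noteq> r" "e = {v, p v}" by (auto simp: tree_edges_def)
    have sub: "(adj (tree_edges - {{v, p v}}))\<^sup>* \<subseteq> (adj (H - {e}))\<^sup>*"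
      using assms(1) v by (intro rtrancl_mono adj_mono) auto
    obtain w u where wu: "w \<in> V" "u \<in> V" "{w, u} \<in> H - {e}" "v \<in> ancestors p w" "v \<notin> ancestors p u"
      using cover[OF v(1,2)] v(3) by blast
    have "(v, w) \<in> (adj (H - {e}))\<^sup>*"
      by (rule adj_rtrancl_sym) (rule subsetD[OF sub subtree_path[OF v(1,2) wu(1,4)]])
    moreover have "(w, u) \<in> adj (H - {e})" using wu(3) by simp
    moreover have "(u, r) \<in> (adj (H - {e}))\<^sup>*"
      by (rule subsetD[OF sub outside_subtree_path[OF v(1,2) wu(2,5)]])
    ultimately have vr: "(v, r) \<in> (adj (H - {e}))\<^sup>*" by (rule rtrancl_trans[OF rtrancl_into_rtrancl])
    show ?thesis
    proof (rule graph_connected_via_root)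
      fix x assume x: "x \<in> V"
      show "(x, r) \<in> (adj (H - {e}))\<^sup>*"
      proof (cases "v \<in> ancestors p x")
        case True
        show ?thesis
          by (rule rtrancl_trans[OF subsetD[OF sub subtree_path[OF v(1,2) x True]] vr])
      next
        case False
        show ?thesis
          by (rule subsetD[OF sub outside_subtree_path[OF v(1,2) x False]])
      qed
    qed
  qed
  then show ?thesis
    using conn graph_connected_mono[OF _ assms(1)] by (auto simp: two_edge_connected_def)
qed

text \<open>A path from \<open>v\<close> to the root that avoids \<open>{v, p v}\<close> has to
  leave the subtree of \<open>v\<close>, and \<open>{v, p v}\<close> is the only tree edge that does
  so.\<close>

lemma edge_leaving_subtree:
  assumes "two_edge_connected V E" "v \<in> V" "v \<noteq> r"
  obtains w u where "{w, u} \<in> E" "v \<in> ancestors p w" "v \<notin> ancestors p u" "p w \<noteq> u" "p u \<noteq> w"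
proof -
  let ?S = "{x. v \<in> ancestors p x}"
  have "(v, r) \<in> (adj (E - {{v, p v}}))\<^sup>*"
    using assms parent_edge root by (auto simp: two_edge_connected_def graph_connected_def)
  moreover have "v \<in> ?S" "r \<notin> ?S" using assms(3) by auto
  ultimately obtain w u where wu: "(w, u) \<in> adj (E - {{v, p v}})" "w \<in> ?S" "u \<notin> ?S"
    by (rule rtrancl_leaves_set)
  have "p w \<noteq> u"
    using wu ancestors_unfold[of p w] by auto
  moreover have "p u \<noteq> w"
    using wu ancestors_unfold[of p u] by auto
  ultimately show ?thesis using that wu by auto
qed

end

section \<open>The algorithm\<close>

text \<open>
  Arguments: \<open>v\<close> is the identifier of the vertex, \<open>p\<close> its parent (the root is its own parent),
  \<open>m\<close> the length of a phase minus one and \<open>j\<close> the round within the phase. The remaining ones are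
  \<^item> \<open>Flooding v t (L, d) M\<close>: the round \<open>t\<close>, the leader, the distance to it, the largest distance;
  \<^item> \<open>Tracing v p m j a Q\<close>: the \<open>j\<close>-th ancestor \<open>a\<close> of \<open>v\<close>, and the pairs of a vertex (\<open>v\<close> or
    a neighbour) and an ancestor of it that are known so far;
  \<^item> \<open>Converging v p m j g\<close>: the best covering edge found so far, coded as the number of common
    ancestors of its ends, its end in the subtree of \<open>v\<close>, and its other end;
  \<^item> \<open>Informing v p m j b F\<close>: the edge chosen by the \<open>j\<close>-th ancestor, and the output so far.
\<close>

datatype node_state =
    Flooding nat nat "nat \<times> nat" nat
  | Tracing nat nat nat nat nat "(nat \<times> nat) fset"
  | Converging nat nat nat nat "nat \<times> nat \<times> nat"
  | Informing nat nat nat nat "nat \<times> nat \<times> nat" "nat fset"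
  | Halted "nat fset"

instance node_state :: countable
  by countable_datatype

text \<open>All vertices change phase in the same round, so packets carry no phase tag. After the
  flooding the first entry is the parent of the sender, by which a vertex recognises its
  children.\<close>

type_synonym packet = "nat \<times> nat \<times> nat \<times> nat"

text \<open>In a connected network a vertex without neighbours is alone, and it must halt in round 0
  because the diameter is 0.\<close>

fun start :: "nat \<Rightarrow> nat set \<Rightarrow> node_state" where
  "start v N = (if N = {} then Halted {||} else Flooding v 0 (v, 0) 0)"

fun broadcast :: "node_state \<Rightarrow> packet" where
  "broadcast (Flooding v t P M) = (0, fst P, snd P, M)"
| "broadcast (Tracing v p m j a Q) = (p, a, 0, 0)"
| "broadcast (Converging v p m j g) = (p, g)"
| "broadcast (Informing v p m j b F) = (p, b)"
| "broadcast (Halted F) = (0, 0, 0, 0)"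

fun outcome :: "node_state \<Rightarrow> nat set option" where
  "outcome (Halted F) = Some (fset F)"
| "outcome _ = None"

text \<open>The order on pairs and triples is lexicographic: while flooding, a smaller identifier
  wins at any distance; later, fewer common ancestors win. Neighbours that are neither children nor
  the parent are the ends of non-tree edges. The root has nobody to ask and keeps its own
  value.\<close>

fun advance :: "node_state \<Rightarrow> (nat \<Rightarrow> packet option) \<Rightarrow> node_state" where
  "advance (Flooding v t P M) \<mu> =
    (let P' = Min (insert P ((\<lambda>x. (fst (snd x), Suc (fst (snd (snd x))))) ` ran \<mu>));
         M' = Max (insert (snd P') (insert M ((\<lambda>x. snd (snd (snd x))) ` ran \<mu>)))
     in if 3 * M' + 2 \<le> Suc t
        then Tracing v
          (if snd P' = 0 then v
           else Min {u \<in> dom \<mu>. fst (snd (the (\<mu> u))) = fst P' \<and>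
                                  Suc (fst (snd (snd (the (\<mu> u))))) = snd P'})
          M' 0 v {||}
        else Flooding v (Suc t) P' M')"
| "advance (Tracing v p m j a Q) \<mu> =
    (let Q' = fset Q \<union> insert (v, a) ((\<lambda>u. (u, fst (snd (the (\<mu> u))))) ` dom \<mu>)
     in if j < m
        then Tracing v p m (Suc j) (if p = v then a else fst (snd (the (\<mu> p)))) (Abs_fset Q')
        else Converging v p m 0
          (Min ((\<lambda>u. (card (Q' `` {v} \<inter> Q' `` {u}), v, u)) `
             insert v {u \<in> dom \<mu>. fst (the (\<mu> u)) \<noteq> v \<and> u \<noteq> p})))"
| "advance (Converging v p m j g) \<mu> =
    (let g' = Min (insert g (snd ` {x \<in> ran \<mu>. fst x = v}))
     in if j < m then Converging v p m (Suc j) g' else Informing v p m 0 g' {||})"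
| "advance (Informing v p m j b F) \<mu> =
    (let F' = Abs_fset (fset F \<union> {u \<in> dom \<mu>. u = p \<or> fst (the (\<mu> u)) = v \<or>
                         snd b = (v, u) \<or> snd (snd (the (\<mu> u))) = (u, v)})
     in if j < m then Informing v p m (Suc j) (if p = v then b else snd (the (\<mu> p))) F'
        else Halted F')"
| "advance (Halted F) \<mu> = Halted F"

section \<open>Coding packets by bit strings of logarithmic length\<close>

fun bits :: "nat \<Rightarrow> bool list" where
  "bits n = (if n = 0 then [] else odd n # bits (n div 2))"

fun unbits :: "bool list \<Rightarrow> nat" where
  "unbits [] = 0"
| "unbits (b # bs) = of_bool b + 2 * unbits bs"

declare bits.simps [simp del]

lemma unbits_bits [simp]: "unbits (bits n) = n"
proof (induction n rule: less_induct)
  case (less n)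
  then show ?case by (cases "n = 0") (simp_all add: bits.simps[of n] bits.simps[of 0])
qed

lemma length_bits: "n < 2 ^ k \<Longrightarrow> length (bits n) \<le> k"
proof (induction k arbitrary: n)
  case (Suc k)
  then show ?case by (auto simp: bits.simps[of n])
qed (simp add: bits.simps)

text \<open>\<open>N \<ge> 2\<close> makes \<open>log 2 N\<close> at least 1, which pays for
  rounding the length up.\<close>

lemma length_bits_log:
  fixes n N q :: nat
  assumes "n < N ^ q" "N \<ge> 2"
  shows "real (length (bits n)) \<le> (q + 1) * log 2 N"
proof -
  let ?k = "nat \<lceil>q * log 2 N\<rceil>"
  have "real n < real N ^ q" using assms(1) by (metis of_nat_less_iff of_nat_power)
  also have "\<dots> = 2 powr (q * log 2 N)"
    using assms(2) by (simp add: powr_powr[symmetric] mult.commute[of "real q"] powr_realpow)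
  also have "\<dots> \<le> 2 powr ?k" by (intro powr_mono) linarith+
  also have "\<dots> = real (2 ^ ?k)" by (simp add: powr_realpow)
  finally have "n < 2 ^ ?k" by (simp only: of_nat_less_iff)
  then have "real (length (bits n)) \<le> real ?k" using length_bits by simp
  moreover have "log 2 N \<ge> 1" using assms(2) by simp
  moreover have "q * log 2 N \<ge> 0" using calculation(2) by simp
  then have "real ?k \<le> q * log 2 N + 1" by linarith
  ultimately have "real (length (bits n)) \<le> q * log 2 N + log 2 N" by linarith
  then show ?thesis by (simp add: distrib_right)
qed

text \<open>The pairing function grows quadratically, which doubles the exponent;
  \<open>N \<ge> 2\<close> absorbs the remaining factor 4 into two further powers.\<close>

lemma prod_encode_less:
  fixes N :: nat
  assumes "a < N ^ k" "b < N ^ k" "N \<ge> 2"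
  shows "prod_encode (a, b) < N ^ (2 * k + 2)"
proof -
  have "triangle s \<le> s * s" for s :: nat by (induction s) auto
  then have "prod_encode (a, b) \<le> (a + b) * (a + b) + a"
    by (simp add: prod_encode_def)
  also have "\<dots> < (a + b + 1) * (a + b + 1)" by simp
  also have "\<dots> \<le> (2 * N ^ k) * (2 * N ^ k)" using assms by (intro mult_mono) auto
  also have "\<dots> \<le> (N * N ^ k) * (N * N ^ k)" using assms by (intro mult_mono) auto
  also have "\<dots> = N ^ (2 * k + 2)" by (simp add: power_add mult_2)
  finally show ?thesis .
qed

definition encode :: "packet \<Rightarrow> bool list" where
  "encode x = bits (prod_encode (fst x, prod_encode (fst (snd x), prod_encode (snd (snd x)))))"

definition decode :: "bool list \<Rightarrow> packet" where
  "decode bs = (let (q, y) = prod_decode (unbits bs); (l, z) = prod_decode y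
                in (q, l, prod_decode z))"

lemma decode_encode [simp]: "decode (encode x) = x"
  by (simp add: decode_def encode_def)

text \<open>Three nested pairings, each turning an exponent \<open>k\<close> into
  \<open>2 * k + 2\<close>, lead to \<open>8 * k + 14\<close>; \<open>length_bits_log\<close> adds
  1.\<close>

lemma length_encode:
  fixes N :: nat
  assumes "q < N ^ k" "l < N ^ k" "d < N ^ k" "z < N ^ k" "N \<ge> 2"
  shows "real (length (encode (q, l, d, z))) \<le> (8 * k + 15) * log 2 N"
proof -
  have up: "a < N ^ i \<Longrightarrow> i \<le> j \<Longrightarrow> a < N ^ j" for a i j
    using assms(5) by (erule_tac less_le_trans) (rule power_increasing, auto)
  have dz: "prod_encode (d, z) < N ^ (2 * k + 2)"
    using assms by (intro prod_encode_less)
  have "l < N ^ (2 * k + 2)" by (rule up[OF assms(2)]) simp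
  then have ldz: "prod_encode (l, prod_encode (d, z)) < N ^ (2 * (2 * k + 2) + 2)"
    using dz assms(5) by (rule prod_encode_less)
  have "q < N ^ (2 * (2 * k + 2) + 2)" by (rule up[OF assms(1)]) simp
  then have "prod_encode (q, prod_encode (l, prod_encode (d, z)))
      < N ^ (2 * (2 * (2 * k + 2) + 2) + 2)"
    using ldz assms(5) by (rule prod_encode_less)
  from length_bits_log[OF this assms(5)] show ?thesis
    by (simp add: encode_def algebra_simps)
qed

section \<open>The algorithm on coded states\<close>

definition ecss_algorithm :: "nat congest_algorithm" where
  "ecss_algorithm = \<lparr>
     init = (\<lambda>v N. to_nat (start v N)),
     send = (\<lambda>s u. Some (encode (broadcast (from_nat s)))),
     receive = (\<lambda>s M. to_nat (advance (from_nat s) (\<lambda>u. map_option decode (M u)))),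
     result = (\<lambda>s. outcome (from_nat s))\<rparr>"

text \<open>With \<open>received\<close>, a view of the run free of codings;
  \<open>message_run\<close> and \<open>state_Suc\<close> justify it.\<close>

definition state :: "nat set set \<Rightarrow> nat \<Rightarrow> nat \<Rightarrow> node_state" where
  "state E t v = from_nat (run ecss_algorithm E t v)"

definition received :: "nat set set \<Rightarrow> nat \<Rightarrow> nat \<Rightarrow> nat \<Rightarrow> packet option" where
  "received E t v u =
     (if u \<in> neighbours E v \<and> outcome (state E t u) = None
      then Some (broadcast (state E t u)) else None)"

lemma result_run: "result ecss_algorithm (run ecss_algorithm E t v) = outcome (state E t v)"
  by (simp add: ecss_algorithm_def state_def)

lemma state_0: "state E 0 v = start v (neighbours E v)"
  by (simp add: state_def ecss_algorithm_def)

lemma message_run: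
  "message ecss_algorithm E (run ecss_algorithm E t) u v =
     map_option encode (received E t v u)"
  unfolding message_def received_def result_run
  by (simp add: neighbours_def insert_commute) (simp add: ecss_algorithm_def state_def)

lemma state_Suc:
  "state E (Suc t) v =
     (if outcome (state E t v) = None then advance (state E t v) (received E t v) else state E t v)"
proof (cases "outcome (state E t v) = None")
  case True
  have "receive ecss_algorithm s M = to_nat (advance (from_nat s) (\<lambda>u. map_option decode (M u)))" for s M
    by (simp add: ecss_algorithm_def)
  then show ?thesis
    using True by (simp add: state_def[of _ "Suc t"] result_run message_run option.map_comp comp_def
      option.map_ident flip: state_def)
next
  case False
  then show ?thesis by (simp add: state_def[of _ "Suc t"] result_run del: not_None_eq flip: state_def)
qed

section \<open>Flooding\<close>

text \<open>\<open>flood\<close> and \<open>far\<close> continue the flooding forever, independently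
  of the states. Before \<open>wake\<close> they are the values \<open>(L, d)\<close> and
  \<open>M\<close> held by the vertices, see \<open>flooding_state\<close>.\<close>

fun flood :: "nat set set \<Rightarrow> nat \<Rightarrow> nat \<Rightarrow> nat \<times> nat" where
  "flood E 0 v = (v, 0)"
| "flood E (Suc t) v = Min (insert (flood E t v)
     ((\<lambda>u. (fst (flood E t u), Suc (snd (flood E t u)))) ` neighbours E v))"

fun far :: "nat set set \<Rightarrow> nat \<Rightarrow> nat \<Rightarrow> nat" where
  "far E 0 v = 0"
| "far E (Suc t) v =
     Max (insert (snd (flood E (Suc t) v)) (insert (far E t v) (far E t ` neighbours E v)))"

declare flood.simps(2) [simp del] far.simps(2) [simp del]

locale connected_network =
  fixes V :: "nat set" and E :: "nat set set"
  assumes graph: "simple_graph V E" and connected: "graph_connected V E"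
begin

section \<open>Walks, distances and the diameter\<close>

lemma finV: "finite V"
  using simple_graph_finite[OF graph] by auto

lemma fin_nbrs [simp]: "finite (neighbours E v)"
  using finite_neighbours[OF graph] .

lemma nbr_in: "u \<in> neighbours E v \<Longrightarrow> u \<in> V"
  using neighbours_subset[OF graph] by blast

lemma walk_in: "(u, v) \<in> adj E ^^ k \<Longrightarrow> u \<in> V \<Longrightarrow> v \<in> V"
  by (induction k arbitrary: v) (auto elim!: relpow_Suc_E dest: simple_graph_edgeD[OF graph])

lemma walk_exists: "u \<in> V \<Longrightarrow> v \<in> V \<Longrightarrow> \<exists>k. (u, v) \<in> adj E ^^ k"
  using connected by (auto simp: graph_connected_def rtrancl_power)

lemma dist_walk: "u \<in> V \<Longrightarrow> v \<in> V \<Longrightarrow> (u, v) \<in> adj E ^^ graph_dist E u v"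
  unfolding graph_dist_def using walk_exists by (meson LeastI_ex)

lemma dist_le: "(u, v) \<in> adj E ^^ k \<Longrightarrow> graph_dist E u v \<le> k"
  unfolding graph_dist_def by (rule Least_le)

lemma dist_le_diameter: "u \<in> V \<Longrightarrow> v \<in> V \<Longrightarrow> graph_dist E u v \<le> graph_diameter V E"
proof -
  assume uv: "u \<in> V" "v \<in> V"
  have "{graph_dist E u v |u v. u \<in> V \<and> v \<in> V} = (\<lambda>(u, v). graph_dist E u v) ` (V \<times> V)"
    by auto
  then have "finite {graph_dist E u v |u v. u \<in> V \<and> v \<in> V}" using finV by simp
  then show ?thesis unfolding graph_diameter_def using uv by (intro Max_ge) auto
qed

text \<open>A crude bound suffices, as only the logarithm of a distance enters the message
  size.\<close>

lemma dist_le_card_square: "u \<in> V \<Longrightarrow> v \<in> V \<Longrightarrow> graph_dist E u v \<le> card V ^ 2"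
proof -
  assume uv: "u \<in> V" "v \<in> V"
  have "adj E \<subseteq> V \<times> V" by (auto dest: simple_graph_edgeD[OF graph])
  moreover have "finite (V \<times> V)" using finV by simp
  ultimately have fin: "finite (adj E)" and "card (adj E) \<le> card (V \<times> V)"
    by (auto intro: finite_subset card_mono)
  then have "card (adj E) \<le> card V ^ 2" by (simp add: card_cartesian_product power2_eq_square)
  moreover have "(u, v) \<in> (adj E)\<^sup>*" using connected uv by (auto simp: graph_connected_def)
  then obtain k where "(u, v) \<in> adj E ^^ k" "k \<le> card (adj E)"
    using rtrancl_finite_eq_relpow[OF fin] by auto
  then have "graph_dist E u v \<le> card (adj E)" using dist_le by fastforce
  ultimately show ?thesis by simp
qed

lemma diameter_pos:
  assumes "card V \<ge> 2"
  shows "graph_diameter V E \<ge> 1"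
proof -
  obtain u where u: "u \<in> V" using assms by fastforce
  have "V \<noteq> {u}" using assms by auto
  then obtain v where v: "v \<in> V" "u \<noteq> v" using u by blast
  have "graph_dist E u v \<noteq> 0" using dist_walk[OF u v(1)] v(2) by (metis relpow_0_E)
  then show ?thesis using dist_le_diameter[OF u v(1)] by simp
qed

section \<open>Invariants of the flooding\<close>

lemma flood_Suc_le: "flood E (Suc t) v \<le> flood E t v"
  by (simp add: flood.simps(2))

lemma flood_Suc_nbr:
  "u \<in> neighbours E v \<Longrightarrow> flood E (Suc t) v \<le> (fst (flood E t u), Suc (snd (flood E t u)))"
  unfolding flood.simps(2) by (rule Min_le) auto

lemma flood_walk:
  "v \<in> V \<Longrightarrow> fst (flood E t v) \<in> V \<and> snd (flood E t v) \<le> t \<and>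
     (fst (flood E t v), v) \<in> adj E ^^ snd (flood E t v)"
proof (induction t arbitrary: v)
  case (Suc t)
  have "flood E (Suc t) v \<in> insert (flood E t v)
      ((\<lambda>u. (fst (flood E t u), Suc (snd (flood E t u)))) ` neighbours E v)"
    unfolding flood.simps(2) by (rule Min_in) auto
  then consider "flood E (Suc t) v = flood E t v"
    | u where "u \<in> neighbours E v" "flood E (Suc t) v = (fst (flood E t u), Suc (snd (flood E t u)))"
    by blast
  then show ?case
  proof cases
    case 1
    then show ?thesis using Suc.IH[OF Suc.prems] by simp
  next
    case 2
    then have "{u, v} \<in> E" by (simp add: neighbours_def insert_commute)
    then show ?thesis
      using Suc.IH[OF nbr_in[OF 2(1)]] 2(2) by (auto intro: relpow_Suc_I)
  qed
qed simp

lemma flood_le: "(w, v) \<in> adj E ^^ k \<Longrightarrow> k \<le> t \<Longrightarrow> flood E t v \<le> (w, k)"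
proof (induction t arbitrary: v k)
  case (Suc t)
  show ?case
  proof (cases k)
    case 0
    then have "flood E t v \<le> (w, k)" using Suc by simp
    then show ?thesis using flood_Suc_le order_trans by blast
  next
    case k: (Suc k')
    then obtain u where u: "(w, u) \<in> adj E ^^ k'" "(u, v) \<in> adj E"
      using Suc.prems(1) by (blast elim: relpow_Suc_E)
    then have "u \<in> neighbours E v" by (simp add: neighbours_def insert_commute)
    then have "flood E (Suc t) v \<le> (fst (flood E t u), Suc (snd (flood E t u)))"
      by (rule flood_Suc_nbr)
    also have "\<dots> \<le> (w, k)"
      using Suc.IH[OF u(1)] Suc.prems(2) k by (auto simp: less_eq_prod_def)
    finally show ?thesis .
  qed
qed simp

text \<open>The walk behind the pair held by \<open>w\<close> in round \<open>s\<close> is prolonged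
  by the walk from \<open>w\<close> to \<open>v\<close>.\<close>

lemma flood_walk_le:
  assumes "(w, v) \<in> adj E ^^ k" "w \<in> V" "s + k \<le> t"
  shows "flood E t v \<le> (fst (flood E s w), snd (flood E s w) + k)"
  using flood_walk[OF assms(2), of s] assms
  by (intro flood_le relpow_trans[of _ w]) auto

text \<open>Distances are exact even for leaders that are given up later: the value held is the
  length of some walk of at most \<open>t\<close> steps, so a shortest walk has been flooded by
  round \<open>t\<close> as well.\<close>

lemma flood_dist: "v \<in> V \<Longrightarrow> snd (flood E t v) = graph_dist E (fst (flood E t v)) v"
proof -
  assume v: "v \<in> V"
  obtain x k where xk: "flood E t v = (x, k)" by fastforce
  then have *: "x \<in> V" "k \<le> t" "(x, v) \<in> adj E ^^ k" using flood_walk[OF v, of t] by auto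
  have "graph_dist E x v \<le> k" using * dist_le by blast
  moreover have "flood E t v \<le> (x, graph_dist E x v)"
    using dist_walk[OF *(1) v] calculation *(2) by (intro flood_le) auto
  ultimately show ?thesis using xk by (simp add: less_eq_prod_def)
qed

lemma far_ge: "(w, v) \<in> adj E ^^ k \<Longrightarrow> s + k \<le> t \<Longrightarrow> snd (flood E s w) \<le> far E t v"
proof (induction t arbitrary: v k)
  case (Suc t)
  show ?case
  proof (cases k)
    case 0
    show ?thesis
    proof (cases "s = Suc t")
      case False
      then have "snd (flood E s w) \<le> far E t v"
        using Suc.IH[of v 0] Suc.prems 0 by simp
      also have "\<dots> \<le> far E (Suc t) v" unfolding far.simps(2) by (rule Max_ge) auto
      finally show ?thesis .
    qed (use Suc.prems 0 in \<open>simp add: far.simps(2)\<close>)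
  next
    case k: (Suc k')
    then obtain u where u: "(w, u) \<in> adj E ^^ k'" "(u, v) \<in> adj E"
      using Suc.prems(1) by (blast elim: relpow_Suc_E)
    then have "u \<in> neighbours E v" by (simp add: neighbours_def insert_commute)
    then have "far E t u \<le> far E (Suc t) v" unfolding far.simps(2) by (intro Max_ge) auto
    moreover have "snd (flood E s w) \<le> far E t u" using Suc.IH[OF u(1)] Suc.prems(2) k by simp
    ultimately show ?thesis by simp
  qed
qed simp

lemma far_attained: "v \<in> V \<Longrightarrow> \<exists>s w. w \<in> V \<and> far E t v = snd (flood E s w)"
proof (induction t arbitrary: v)
  case 0
  then show ?case by (intro exI[of _ 0] exI[of _ v]) simp
next
  case (Suc t)
  have "far E (Suc t) v \<in> insert (snd (flood E (Suc t) v)) (insert (far E t v) (far E t ` neighbours E v))"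
    unfolding far.simps(2) by (rule Max_in) auto
  then consider "far E (Suc t) v = snd (flood E (Suc t) v)" | "far E (Suc t) v = far E t v"
    | u where "u \<in> neighbours E v" "far E (Suc t) v = far E t u"
    by blast
  then show ?case
  proof cases
    case 3
    then show ?thesis using Suc.IH[OF nbr_in] by simp
  qed (use Suc in auto)
qed

lemma far_le_dist:
  assumes "v \<in> V"
  obtains u w where "u \<in> V" "w \<in> V" "far E t v = graph_dist E u w"
  using far_attained[OF assms, of t] flood_dist flood_walk by metis

section \<open>Detecting the end of the flooding\<close>

definition quiet :: "nat \<Rightarrow> nat \<Rightarrow> bool" where
  "quiet t v \<longleftrightarrow> 3 * far E t v + 2 \<le> t"

text \<open>If some vertex had distance \<open>far E t v + 1\<close> from the presumed leader, then a quiet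
  vertex \<open>v\<close> would already have heard from it: either about its distance, or about a smaller
  identifier.\<close>

lemma quiet_radius:
  assumes v: "v \<in> V" and quiet: "quiet t v" and w: "w \<in> V"
  shows "graph_dist E (fst (flood E t v)) w \<le> far E t v"
proof (rule ccontr)
  define M where "M = far E t v"
  obtain x k where xk: "flood E t v = (x, k)" by fastforce
  then have x: "x \<in> V" and xv: "(x, v) \<in> adj E ^^ k" using flood_walk[OF v, of t] by auto
  define e where "e = graph_dist E x w"
  assume "\<not> graph_dist E (fst (flood E t v)) w \<le> far E t v"
  then have "M < e" by (simp add: e_def M_def xk)
  then have "(x, w) \<in> adj E ^^ (Suc M + (e - Suc M))"
    using dist_walk[OF x w] by (simp add: e_def)
  \<comment> \<open>\<open>y\<close> lies on a shortest walk from \<open>x\<close> to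
    \<open>w\<close>, \<open>M + 1\<close> steps from \<open>x\<close>.\<close>
  then obtain y where y: "(x, y) \<in> adj E ^^ Suc M" "(y, w) \<in> adj E ^^ (e - Suc M)"
    unfolding relpow_add by blast
  then have yV: "y \<in> V" using walk_in x by blast
  have y_dist: "graph_dist E x y = Suc M"
  proof (rule antisym)
    show "graph_dist E x y \<le> Suc M" using y(1) by (rule dist_le)
    have "e \<le> graph_dist E x y + (e - Suc M)"
      unfolding e_def by (intro dist_le relpow_trans[OF dist_walk[OF x yV]]) (use y(2) e_def in simp)
    then show "Suc M \<le> graph_dist E x y" using \<open>M < e\<close> by simp
  qed
  have "k \<le> M" using far_ge[of v v 0 t t] xk by (simp add: M_def)
  have yv: "(y, v) \<in> adj E ^^ (Suc M + k)" using adj_relpow_sym[OF y(1)] xv by (rule relpow_trans)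
  \<comment> \<open>The origin of \<open>3 * M + 2\<close>: \<open>x\<close> reaches
    \<open>y\<close> in \<open>M + 1\<close> rounds, and the answer travels back through
    \<open>x\<close> to \<open>v\<close> in \<open>M + 1 + k \<le> 2 * M + 1\<close> rounds.\<close>
  have time: "Suc M + (Suc M + k) \<le> t" using \<open>k \<le> M\<close> quiet by (simp add: quiet_def M_def)
  have "flood E (Suc M) y \<le> (x, Suc M)" using y(1) by (intro flood_le) auto
  \<comment> \<open>A smaller identifier at \<open>y\<close> would have displaced \<open>x\<close>
    at \<open>v\<close> by round \<open>t\<close>.\<close>
  moreover have "x \<le> fst (flood E (Suc M) y)"
    using flood_walk_le[OF yv yV time] xk by (auto simp: less_eq_prod_def)
  ultimately have "fst (flood E (Suc M) y) = x" by (auto simp: less_eq_prod_def)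
  then have "snd (flood E (Suc M) y) = Suc M" using flood_dist[OF yV, of "Suc M"] y_dist by simp
  then have "Suc M \<le> far E t v" using far_ge[OF yv time] by simp
  then show False by (simp add: M_def)
qed

text \<open>Let \<open>M\<close> be \<open>far E t v\<close> and \<open>x\<close> the leader seen by
  \<open>v\<close>. All vertices are within \<open>M\<close> of \<open>x\<close>, hence within
  \<open>2 * M \<le> t\<close> of \<open>v\<close>, so \<open>x\<close> is the least identifier. It
  therefore reaches everyone by round \<open>M\<close>, possibly long before
  \<open>t\<close>.\<close>

lemma quiet_stable:
  assumes v: "v \<in> V" and quiet: "quiet t v" and w: "w \<in> V" and s: "far E t v \<le> s"
  shows "flood E s w = (fst (flood E t v), graph_dist E (fst (flood E t v)) w)"
proof -
  obtain x k where xk: "flood E t v = (x, k)" by fastforce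
  then have x: "x \<in> V" and xv: "(x, v) \<in> adj E ^^ k" using flood_walk[OF v, of t] by auto
  have radius: "graph_dist E x u \<le> far E t v" if "u \<in> V" for u
    using quiet_radius[OF v quiet that] xk by simp
  have kM: "k \<le> far E t v" using far_ge[of v v 0 t t] xk by simp
  have least: "x \<le> u" if u: "u \<in> V" for u
  proof -
    have "(u, v) \<in> adj E ^^ (graph_dist E x u + k)"
      using adj_relpow_sym[OF dist_walk[OF x u]] xv by (rule relpow_trans)
    moreover have "graph_dist E x u + k \<le> t" using radius[OF u] kM quiet by (simp add: quiet_def)
    ultimately show ?thesis using flood_le xk by (fastforce simp: less_eq_prod_def)
  qed
  have "flood E s w \<le> (x, graph_dist E x w)"
    using dist_walk[OF x w] radius[OF w] s by (intro flood_le) auto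
  then have "fst (flood E s w) = x"
    using least[of "fst (flood E s w)"] flood_walk[OF w, of s] by (auto simp: less_eq_prod_def)
  then show ?thesis using flood_dist[OF w, of s] xk by (simp add: prod_eq_iff)
qed

text \<open>No vertex ever has a distance above \<open>far E t v\<close>: in a round
  \<open>s\<close> before round \<open>far E t v\<close> it is at most \<open>s\<close>, and
  afterwards it is final and \<open>quiet_radius\<close> applies.\<close>

lemma quiet_far_le:
  assumes v: "v \<in> V" and quiet: "quiet t v" and u: "u \<in> V"
  shows "far E t u \<le> far E t v"
proof -
  obtain s w where w: "w \<in> V" "far E t u = snd (flood E s w)" using far_attained[OF u] by blast
  have "snd (flood E s w) \<le> far E t v"
  proof (cases "far E t v \<le> s")
    case True
    then show ?thesis
      using quiet_stable[OF v quiet w(1)] quiet_radius[OF v quiet w(1)] by simp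
  next
    case False
    then show ?thesis using flood_walk[OF w(1), of s] by simp
  qed
  then show ?thesis using w(2) by simp
qed

lemma quiet_all:
  assumes v: "v \<in> V" "quiet t v" and u: "u \<in> V"
  shows "quiet t u \<and> far E t u = far E t v"
proof -
  have le: "far E t u \<le> far E t v" by (rule quiet_far_le[OF v u])
  then have "quiet t u" using v(2) by (simp add: quiet_def)
  then show ?thesis using quiet_far_le[OF u _ v(1), of t] le by simp
qed

text \<open>\<open>far\<close> never exceeds the diameter, since every distance held is a true
  distance. Thus the end is noticed in time although the diameter is unknown.\<close>

lemma quiet_at_diameter: "v \<in> V \<Longrightarrow> quiet (3 * graph_diameter V E + 2) v"
  unfolding quiet_def using far_le_dist dist_le_diameter by (metis add_le_mono1 mult_le_mono2)

section \<open>The BFS tree known in the common wake-up round\<close>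

definition wake :: nat where
  "wake = (LEAST t. \<exists>v\<in>V. quiet t v)"

text \<open>\<open>Min V\<close> is just a fixed vertex; by \<open>wake_quiet\<close> and
  \<open>flood_stable\<close> all vertices agree on the radius and the leader.\<close>

definition radius :: nat where
  "radius = far E wake (Min V)"

definition leader :: nat where
  "leader = fst (flood E wake (Min V))"

definition depth :: "nat \<Rightarrow> nat" where
  "depth v = graph_dist E leader v"

text \<open>The minimum breaks ties exactly as \<open>advance\<close> does.\<close>

definition parent :: "nat \<Rightarrow> nat" where
  "parent v = (if depth v = 0 then v else Min {u \<in> neighbours E v. Suc (depth u) = depth v})"

lemma MinV: "Min V \<in> V"
  using finV graph by (auto simp: simple_graph_def)

lemma wake_quiet: "v \<in> V \<Longrightarrow> quiet wake v \<and> far E wake v = radius"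
proof -
  assume v: "v \<in> V"
  have "\<exists>v\<in>V. quiet wake v"
    unfolding wake_def by (rule LeastI) (use quiet_at_diameter v in blast)
  then have "quiet wake (Min V)" using quiet_all MinV by blast
  then show ?thesis using quiet_all[OF MinV _ v] by (simp add: radius_def)
qed

lemma not_quiet_before: "t < wake \<Longrightarrow> v \<in> V \<Longrightarrow> \<not> quiet t v"
  unfolding wake_def using not_less_Least by blast

lemma wake_le: "wake \<le> 3 * graph_diameter V E + 2"
  unfolding wake_def by (rule Least_le) (use quiet_at_diameter MinV in blast)

text \<open>The pairs exchanged in the last flooding round are thus already final, and parents can
  be read off them.\<close>

lemma wake_gt: "Suc radius < wake"
  using wake_quiet[OF MinV] by (simp add: quiet_def)

lemma radius_le: "radius \<le> graph_diameter V E"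
proof -
  obtain u w where "u \<in> V" "w \<in> V" "radius = graph_dist E u w"
    unfolding radius_def using far_le_dist[OF MinV] by blast
  then show ?thesis using dist_le_diameter by simp
qed

lemma leader_in: "leader \<in> V"
  unfolding leader_def using flood_walk[OF MinV] by blast

lemma flood_stable: "w \<in> V \<Longrightarrow> radius \<le> s \<Longrightarrow> flood E s w = (leader, depth w)"
  using quiet_stable[OF MinV, of wake] wake_quiet[OF MinV] by (simp add: leader_def depth_def)

lemma depth_le: "w \<in> V \<Longrightarrow> depth w \<le> radius"
  using quiet_radius[OF MinV, of wake] wake_quiet[OF MinV] by (simp add: leader_def depth_def)

lemma depth_0_iff: "v \<in> V \<Longrightarrow> depth v = 0 \<longleftrightarrow> v = leader"
proof
  assume "v \<in> V" "depth v = 0"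
  then show "v = leader" using dist_walk[OF leader_in \<open>v \<in> V\<close>] by (auto simp: depth_def)
next
  assume "v = leader"
  then show "depth v = 0" using dist_le[of v v 0] by (simp add: depth_def)
qed

lemma parent_step:
  assumes v: "v \<in> V" "v \<noteq> leader"
  shows "parent v \<in> neighbours E v \<and> Suc (depth (parent v)) = depth v"
proof -
  have pos: "depth v \<noteq> 0" using v depth_0_iff by simp
  then obtain k where k: "depth v = Suc k" by (cases "depth v") auto
  have "(leader, v) \<in> adj E ^^ Suc k" using dist_walk[OF leader_in v(1)] k by (simp add: depth_def)
  then obtain u where u: "(leader, u) \<in> adj E ^^ k" "(u, v) \<in> adj E" by (blast elim: relpow_Suc_E)
  then have nbr: "u \<in> neighbours E v" by (simp add: neighbours_def insert_commute)
  have "depth u \<le> k" using dist_le[OF u(1)] by (simp add: depth_def)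
  moreover have "(leader, v) \<in> adj E ^^ Suc (depth u)"
    using dist_walk[OF leader_in nbr_in[OF nbr]] u(2) by (auto simp: depth_def)
  then have "Suc k \<le> Suc (depth u)" using dist_le k by (metis depth_def)
  ultimately have "u \<in> {u \<in> neighbours E v. Suc (depth u) = depth v}" using nbr k by simp
  then have "Min {u \<in> neighbours E v. Suc (depth u) = depth v}
      \<in> {u \<in> neighbours E v. Suc (depth u) = depth v}"
    by (intro Min_in) auto
  then show ?thesis using pos by (simp add: parent_def)
qed

sublocale tree: spanning_tree V E leader parent depth radius
proof
  show "parent leader = leader" using depth_0_iff[OF leader_in] by (simp add: parent_def)
  show "{v, parent v} \<in> E" if "v \<in> V" "v \<noteq> leader" for v
    using parent_step[OF that] by (simp add: neighbours_def)
  show "depth v = Suc (depth (parent v))" if "v \<in> V" "v \<noteq> leader" for v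
    using parent_step[OF that] by simp
qed (use graph leader_in depth_le in auto)

end

section \<open>Covering the tree edges\<close>

context connected_network
begin

text \<open>The self-loop at \<open>v\<close>, which covers nothing, keeps the set nonempty.\<close>

definition key :: "nat \<Rightarrow> nat \<times> nat \<times> nat" where
  "key v = Min ((\<lambda>u. (card (ancestors parent v \<inter> ancestors parent u), v, u)) `
     insert v {u \<in> neighbours E v. parent u \<noteq> v \<and> u \<noteq> parent v})"

text \<open>The convergecast after \<open>j\<close> rounds: a minimum over the descendants at most
  \<open>j\<close> levels below.\<close>

fun subtree_key :: "nat \<Rightarrow> nat \<Rightarrow> nat \<times> nat \<times> nat" where
  "subtree_key 0 v = key v"
| "subtree_key (Suc j) v =
     Min (insert (subtree_key j v) (subtree_key j ` {u \<in> neighbours E v. parent u = v}))"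

definition best :: "nat \<Rightarrow> nat \<times> nat \<times> nat" where
  "best = subtree_key (Suc radius)"

text \<open>The condition \<open>{w, u} \<in> E\<close> discards self-loops carried by
  \<open>best\<close>.\<close>

definition solution :: "nat set set" where
  "solution = tree.tree_edges \<union> {{w, u} |w u. {w, u} \<in> E \<and> (\<exists>x\<in>V. snd (best x) = (w, u))}"

section \<open>Minimal keys of subtrees and the edges they select\<close>

lemma key_cases:
  obtains u where "u = v \<or> u \<in> neighbours E v \<and> parent u \<noteq> v \<and> u \<noteq> parent v"
    "key v = (card (ancestors parent v \<inter> ancestors parent u), v, u)"
proof -
  have "key v \<in> (\<lambda>u. (card (ancestors parent v \<inter> ancestors parent u), v, u)) `
     insert v {u \<in> neighbours E v. parent u \<noteq> v \<and> u \<noteq> parent v}"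
    unfolding key_def by (rule Min_in) auto
  then show ?thesis using that by blast
qed

lemma key_le:
  assumes "u \<in> neighbours E v" "parent u \<noteq> v" "u \<noteq> parent v"
  shows "fst (key v) \<le> card (ancestors parent v \<inter> ancestors parent u)"
proof -
  have "key v \<le> (card (ancestors parent v \<inter> ancestors parent u), v, u)"
    unfolding key_def using assms by (intro Min_le) auto
  then show ?thesis by (auto simp: less_eq_prod_def)
qed

lemma subtree_key_in:
  "v \<in> V \<Longrightarrow> \<exists>w\<in>V. v \<in> ancestors parent w \<and> subtree_key j v = key w"
proof (induction j arbitrary: v)
  case 0
  then show ?case by (intro bexI[of _ v]) simp_all
next
  case (Suc j)
  have "subtree_key (Suc j) v \<in>
      insert (subtree_key j v) (subtree_key j ` {u \<in> neighbours E v. parent u = v})"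
    unfolding subtree_key.simps by (rule Min_in) auto
  then consider "subtree_key (Suc j) v = subtree_key j v"
    | u where "u \<in> neighbours E v" "parent u = v" "subtree_key (Suc j) v = subtree_key j u"
    by blast
  then show ?case
  proof cases
    case 1
    then show ?thesis using Suc.IH[OF Suc.prems] by (simp only:)
  next
    case 2
    then obtain w where w: "w \<in> V" "u \<in> ancestors parent w" "subtree_key j u = key w"
      using Suc.IH[OF nbr_in] by blast
    have "v \<in> ancestors parent w"
      using ancestors_trans[OF ancestors_step w(2)] 2(2) by simp
    then show ?thesis using w(1,3) 2(3) by (intro bexI[of _ w]) (simp_all only: simp_thms)
  qed
qed

lemma subtree_key_le:
  "w \<in> V \<Longrightarrow> i \<le> j \<Longrightarrow> subtree_key j ((parent ^^ i) w) \<le> key w"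
proof (induction j arbitrary: i)
  case (Suc j)
  show ?case
  proof (cases i)
    case 0
    then have "subtree_key j ((parent ^^ i) w) \<le> key w" using Suc.IH[of 0] Suc.prems(1) by simp
    moreover have "subtree_key (Suc j) ((parent ^^ i) w) \<le> subtree_key j ((parent ^^ i) w)"
      unfolding subtree_key.simps by (rule Min_le) auto
    ultimately show ?thesis by (rule order_trans[rotated])
  next
    case i: (Suc i')
    let ?u = "(parent ^^ i') w"
    have uV: "?u \<in> V" using Suc.prems tree.iter_parent_in by blast
    have IH: "subtree_key j ?u \<le> key w" using Suc i by simp
    have "subtree_key (Suc j) (parent ?u) \<le> subtree_key j ?u"
    proof (cases "?u = leader")
      \<comment> \<open>The leader is its own parent but not its own neighbour, so the inserted own
        value has to account for this step.\<close>
      case True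
      then have "parent ?u = ?u" using tree.root by simp
      then show ?thesis unfolding subtree_key.simps by (intro Min_le) auto
    next
      case False
      then have "?u \<in> neighbours E (parent ?u)"
        using parent_step[OF uV] by (simp add: neighbours_def insert_commute)
      then show ?thesis unfolding subtree_key.simps by (intro Min_le) auto
    qed
    then show ?thesis using IH i by (auto intro: order_trans)
  qed
qed simp

lemma best_in: "v \<in> V \<Longrightarrow> \<exists>w\<in>V. v \<in> ancestors parent w \<and> best v = key w"
  unfolding best_def by (rule subtree_key_in)

lemma best_le: "w \<in> V \<Longrightarrow> v \<in> ancestors parent w \<Longrightarrow> best v \<le> key w"
  using tree.ancestors_bounded[of w] subtree_key_le[of w _ "Suc radius"]
  by (auto simp: best_def simp del: subtree_key.simps)

text \<open>Some non-tree edge leaves the subtree of \<open>v\<close>, so its ends have fewer common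
  ancestors than \<open>v\<close> has ancestors. The minimal edge has no more, so it leaves too and
  in particular is no self-loop.\<close>

lemma best_covers:
  assumes "two_edge_connected V E" "v \<in> V" "v \<noteq> leader"
  shows "\<exists>w\<in>V. \<exists>u\<in>V. {w, u} \<in> solution - {{v, parent v}} \<and>
    v \<in> ancestors parent w \<and> v \<notin> ancestors parent u"
proof -
  obtain w' u' where e': "{w', u'} \<in> E" "v \<in> ancestors parent w'" "v \<notin> ancestors parent u'"
      "parent w' \<noteq> u'" "parent u' \<noteq> w'"
    using tree.edge_leaving_subtree[OF assms] .
  have V': "w' \<in> V" "u' \<in> V" using simple_graph_edgeD[OF graph e'(1)] by auto
  obtain w where w: "w \<in> V" "v \<in> ancestors parent w" "best v = key w"
    using best_in[OF assms(2)] by blast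
  obtain u where u: "u = w \<or> u \<in> neighbours E w \<and> parent u \<noteq> w \<and> u \<noteq> parent w"
      "key w = (card (ancestors parent w \<inter> ancestors parent u), w, u)"
    using key_cases .
  have uV: "u \<in> V" using u(1) w(1) nbr_in by blast
  have "fst (best v) \<le> fst (key w')"
    using best_le[OF V'(1) e'(2)] by (auto simp: less_eq_prod_def)
  also have "\<dots> \<le> card (ancestors parent w' \<inter> ancestors parent u')"
    using e' by (intro key_le) (auto simp: neighbours_def)
  also have "\<dots> < card (ancestors parent v)"
    using tree.card_common_ancestors_less_iff[OF V' e'(2)] e'(3) by blast
  finally have notin: "v \<notin> ancestors parent u"
    using tree.card_common_ancestors_less_iff[OF w(1) uV w(2)] w(3) u(2) by simp
  then have "u \<noteq> w" using w(2) by blast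
  then have edge: "{w, u} \<in> E" "parent u \<noteq> w" "u \<noteq> parent w" using u(1) by (auto simp: neighbours_def)
  then have "{w, u} \<noteq> {v, parent v}" by (auto simp: doubleton_eq_iff)
  moreover have "snd (best v) = (w, u)" using w(3) u(2) by simp
  then have "{w, u} \<in> solution" using edge(1) assms(2) by (auto simp: solution_def)
  ultimately show ?thesis using w(1,2) uV notin by blast
qed

section \<open>The approximation guarantee\<close>

lemma solution_2ecss:
  assumes "two_edge_connected V E"
  shows "is_2ecss V E solution"
  unfolding is_2ecss_def
proof
  show "solution \<subseteq> E" using tree.tree_edges_subset by (auto simp: solution_def)
  show "two_edge_connected V solution"
    by (rule tree.two_edge_connected_augmented[OF _ best_covers[OF assms]])
      (auto simp: solution_def)
qed

lemma card_solution: "card solution \<le> 2 * card V"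
proof -
  have "solution \<subseteq> (\<lambda>v. {v, parent v}) ` V \<union> (\<lambda>x. {fst (snd (best x)), snd (snd (best x))}) ` V"
  proof
    fix e assume "e \<in> solution"
    then consider v where "v \<in> V" "e = {v, parent v}"
      | w u x where "x \<in> V" "snd (best x) = (w, u)" "e = {w, u}"
      unfolding solution_def tree.tree_edges_def by blast
    then show "e \<in> (\<lambda>v. {v, parent v}) ` V \<union> (\<lambda>x. {fst (snd (best x)), snd (snd (best x))}) ` V"
      by cases (auto intro: rev_image_eqI)
  qed
  then have "card solution \<le> card ((\<lambda>v. {v, parent v}) ` V \<union>
      (\<lambda>x. {fst (snd (best x)), snd (snd (best x))}) ` V)"
    using finV by (intro card_mono) auto
  also have "\<dots> \<le> card V + card V"
    by (intro order_trans[OF card_Un_le] add_mono card_image_le finV)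
  finally show ?thesis by simp
qed

lemma solution_two_approx:
  assumes "two_edge_connected V E" "card V \<ge> 2"
  shows "two_approx_2ecss V E solution"
  using solution_2ecss[OF assms(1)] card_solution opt_2ecss_ge[OF graph assms]
  by (simp add: two_approx_2ecss_def)

text \<open>A form that vertices can evaluate locally. The first end of the edge chosen by
  \<open>x\<close> lies in the subtree of \<open>x\<close>, so it finds the edge among the choices
  of its ancestors; the other end hears of it across the edge itself.\<close>

lemma neighbours_solution:
  assumes "v \<in> V"
  shows "neighbours solution v = {u \<in> neighbours E v. u = parent v \<or> parent u = v \<or>
    (\<exists>i\<le>radius. snd (best ((parent ^^ i) v)) = (v, u) \<or> snd (best ((parent ^^ i) u)) = (u, v))}"
proof -
  have chosen: "(\<exists>x\<in>V. snd (best x) = (w, u)) \<longleftrightarrow> (\<exists>i\<le>radius. snd (best ((parent ^^ i) w)) = (w, u))"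
    if "w \<in> V" for w u
  proof
    assume "\<exists>x\<in>V. snd (best x) = (w, u)"
    then obtain x where x: "x \<in> V" "snd (best x) = (w, u)" by blast
    obtain y where y: "y \<in> V" "x \<in> ancestors parent y" "best x = key y"
      using best_in[OF x(1)] by blast
    moreover have "fst (snd (key y)) = y" using key_cases[of y] by (metis fst_conv snd_conv)
    ultimately have "x \<in> ancestors parent w" using x(2) by simp
    then show "\<exists>i\<le>radius. snd (best ((parent ^^ i) w)) = (w, u)"
      using tree.ancestors_bounded[OF that] x(2) by auto
  qed (use tree.iter_parent_in that in blast)
  have solution_iff: "{v, u} \<in> solution \<longleftrightarrow> {v, u} \<in> E \<and> (u = parent v \<or> parent u = v \<or>
      (\<exists>x\<in>V. snd (best x) = (v, u)) \<or> (\<exists>x\<in>V. snd (best x) = (u, v)))" for u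
  proof (cases "{v, u} \<in> E")
    case True
    have "{v, u} \<in> {{w, u} |w u. {w, u} \<in> E \<and> (\<exists>x\<in>V. snd (best x) = (w, u))} \<longleftrightarrow>
        (\<exists>x\<in>V. snd (best x) = (v, u)) \<or> (\<exists>x\<in>V. snd (best x) = (u, v))"
      using True by (simp add: doubleton_eq_iff) (metis insert_commute)
    then show ?thesis using tree.tree_edges_iff[OF True] True by (auto simp: solution_def)
  next
    case False
    then show ?thesis using tree.tree_edges_subset by (auto simp: solution_def)
  qed
  show ?thesis
  proof (rule set_eqI)
    fix u
    show "u \<in> neighbours solution v \<longleftrightarrow> u \<in> {u \<in> neighbours E v. u = parent v \<or> parent u = v \<or>
      (\<exists>i\<le>radius. snd (best ((parent ^^ i) v)) = (v, u) \<or> snd (best ((parent ^^ i) u)) = (u, v))}"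
    proof (cases "{v, u} \<in> E")
      case True
      then have u: "u \<in> V" using simple_graph_edgeD[OF graph] by blast
      show ?thesis
        unfolding neighbours_def mem_Collect_eq solution_iff chosen[OF assms] chosen[OF u] by blast
    qed (simp add: neighbours_def solution_iff)
  qed
qed

end

section \<open>Execution of the algorithm\<close>

lemma ran_restricted: "ran (\<lambda>u. if u \<in> N then Some (f u) else None) = f ` N"
  by (auto simp: ran_def)

lemma dom_restricted: "dom (\<lambda>u. if u \<in> N then Some (f u) else None) = N"
  by (auto simp: dom_def)

locale nontrivial_network = connected_network +
  assumes nontrivial: "card V \<ge> 2"
begin

lemma nbrs_nonempty: "v \<in> V \<Longrightarrow> neighbours E v \<noteq> {}"
proof -
  assume v: "v \<in> V"
  obtain e where e: "e \<in> E" "v \<in> e"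
    using connected_incident_edge[OF graph connected nontrivial v] .
  then obtain u where "e = {v, u}" using graph unfolding simple_graph_def by (metis card_2_iff insertE insert_commute singletonD)
  then show ?thesis using e by (auto simp: neighbours_def)
qed

lemma received_running:
  assumes "\<And>u. u \<in> V \<Longrightarrow> outcome (state E t u) = None"
  shows "received E t v = (\<lambda>u. if u \<in> neighbours E v then Some (broadcast (state E t u)) else None)"
  using assms nbr_in by (auto simp: received_def fun_eq_iff)

lemma flooding_step:
  assumes "\<And>v. v \<in> V \<Longrightarrow> state E t v = Flooding v t (flood E t v) (far E t v)" "v \<in> V"
  shows "state E (Suc t) v = (if quiet (Suc t) v
     then Tracing v
       (if snd (flood E (Suc t) v) = 0 then v
        else Min {u \<in> neighbours E v. fst (flood E t u) = fst (flood E (Suc t) v) \<and>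
                                    Suc (snd (flood E t u)) = snd (flood E (Suc t) v)})
       (far E (Suc t) v) 0 v {||}
     else Flooding v (Suc t) (flood E (Suc t) v) (far E (Suc t) v))"
proof -
  let ?f = "\<lambda>u. (0::nat, fst (flood E t u), snd (flood E t u), far E t u)"
  have "received E t v = (\<lambda>u. if u \<in> neighbours E v then Some (broadcast (state E t u)) else None)"
    using assms by (intro received_running) simp
  also have "\<dots> = (\<lambda>u. if u \<in> neighbours E v then Some (?f u) else None)"
    using assms nbr_in by (auto simp: fun_eq_iff)
  finally have rec: "received E t v = \<dots>" .
  have filt: "{u \<in> neighbours E v. P (the (received E t v u))} = {u \<in> neighbours E v. P (?f u)}" for P
    unfolding rec by auto
  have dom: "dom (received E t v) = neighbours E v" unfolding rec by (rule dom_restricted)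
  have ran: "ran (received E t v) = ?f ` neighbours E v" unfolding rec by (rule ran_restricted)
  have P: "Min (insert (flood E t v) ((\<lambda>x. (fst (snd x), Suc (fst (snd (snd x))))) ` ran (received E t v)))
      = flood E (Suc t) v"
    unfolding ran image_image by (simp add: flood.simps(2))
  have M: "Max (insert (snd (flood E (Suc t) v)) (insert (far E t v)
      ((\<lambda>x. snd (snd (snd x))) ` ran (received E t v)))) = far E (Suc t) v"
    unfolding ran image_image by (simp add: far.simps(2))
  have "state E (Suc t) v = advance (Flooding v t (flood E t v) (far E t v)) (received E t v)"
    using assms by (simp add: state_Suc)
  then show ?thesis
    unfolding advance.simps Let_def P M dom quiet_def
    using filt[of "\<lambda>x. fst (snd x) = fst (flood E (Suc t) v) \<and>
       Suc (fst (snd (snd x))) = snd (flood E (Suc t) v)"] by simp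
qed

lemma flooding_state:
  "t < wake \<Longrightarrow> v \<in> V \<Longrightarrow> state E t v = Flooding v t (flood E t v) (far E t v)"
proof (induction t arbitrary: v)
  case 0
  then show ?case using nbrs_nonempty by (simp add: state_0)
next
  case (Suc t)
  then show ?case using flooding_step[of t v] not_quiet_before by simp
qed

section \<open>Tracing the ancestors\<close>

definition traced :: "nat \<Rightarrow> nat \<Rightarrow> (nat \<times> nat) set" where
  "traced j v = (SIGMA u:insert v (neighbours E v). (\<lambda>i. (parent ^^ i) u) ` {..<j})"

lemma finite_traced [simp]: "finite (traced j v)"
  by (auto simp: traced_def)

lemma traced_Suc:
  "traced (Suc j) v = traced j v \<union>
     insert (v, (parent ^^ j) v) ((\<lambda>u. (u, (parent ^^ j) u)) ` neighbours E v)"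
  by (auto simp: traced_def lessThan_Suc)

text \<open>After the full phase the recorded ancestors are complete, so the counts formed by a
  vertex are those in \<open>key\<close>.\<close>

lemma traced_image:
  "u \<in> V \<Longrightarrow> u \<in> insert v (neighbours E v) \<Longrightarrow> traced (Suc radius) v `` {u} = ancestors parent u"
  by (auto simp: traced_def tree.ancestors_bounded lessThan_Suc_atMost)

lemma waking_state:
  assumes v: "v \<in> V"
  shows "state E wake v = Tracing v (parent v) radius 0 v (Abs_fset (traced 0 v))"
proof -
  obtain t where t: "wake = Suc t" using wake_gt by (cases wake) auto
  then have "radius \<le> t" using wake_gt by simp
  then have par: "(if snd (flood E wake v) = 0 then v
        else Min {u \<in> neighbours E v. fst (flood E t u) = fst (flood E wake v) \<and>
                                    Suc (snd (flood E t u)) = snd (flood E wake v)}) = parent v"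
    using flood_stable nbr_in v t unfolding parent_def
    by (auto intro!: arg_cong[where f = Min])
  moreover have "traced 0 v = {}" by (simp add: traced_def)
  ultimately show ?thesis
    using flooding_step[of t v] flooding_state wake_quiet[OF v] v
    unfolding t[symmetric] par by (simp add: t bot_fset_def)
qed

lemma parent_nbr: "v \<in> V \<Longrightarrow> parent v \<noteq> v \<Longrightarrow> parent v \<in> neighbours E v"
  using parent_step tree.root by metis

lemma iter_parent_commute: "(parent ^^ j) (parent v) = parent ((parent ^^ j) v)"
  by (simp add: funpow_swap1)

lemma iter_parent_fixed: "parent v = v \<Longrightarrow> (parent ^^ j) v = v"
  by (induction j) auto

lemma tracing_step:
  assumes S: "\<And>v. v \<in> V \<Longrightarrow>
      state E t v = Tracing v (parent v) radius j ((parent ^^ j) v) (Abs_fset (traced j v))"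
    and v: "v \<in> V"
  shows "state E (Suc t) v =
    (if j < radius
     then Tracing v (parent v) radius (Suc j) ((parent ^^ Suc j) v) (Abs_fset (traced (Suc j) v))
     else Converging v (parent v) radius 0
       (Min ((\<lambda>u. (card (traced (Suc j) v `` {v} \<inter> traced (Suc j) v `` {u}), v, u)) `
             insert v {u \<in> neighbours E v. parent u \<noteq> v \<and> u \<noteq> parent v})))"
proof -
  let ?f = "\<lambda>u. (parent u, (parent ^^ j) u, 0::nat, 0::nat)"
  have "received E t v = (\<lambda>u. if u \<in> neighbours E v then Some (broadcast (state E t u)) else None)"
    using S by (intro received_running) simp
  also have "\<dots> = (\<lambda>u. if u \<in> neighbours E v then Some (?f u) else None)"
    using S nbr_in by (auto simp: fun_eq_iff)
  finally have rec: "received E t v = \<dots>" .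
  have dom: "dom (received E t v) = neighbours E v" unfolding rec by (rule dom_restricted)
  have filt: "{u \<in> neighbours E v. fst (the (received E t v u)) \<noteq> v \<and> u \<noteq> parent v}
      = {u \<in> neighbours E v. parent u \<noteq> v \<and> u \<noteq> parent v}"
    unfolding rec by auto
  have "(\<lambda>u. (u, fst (snd (the (received E t v u))))) ` neighbours E v
      = (\<lambda>u. (u, (parent ^^ j) u)) ` neighbours E v"
    unfolding rec by auto
  then have Q: "fset (Abs_fset (traced j v)) \<union> insert (v, (parent ^^ j) v)
      ((\<lambda>u. (u, fst (snd (the (received E t v u))))) ` neighbours E v) = traced (Suc j) v"
    by (simp add: Abs_fset_inverse traced_Suc)
  \<comment> \<open>The \<open>j\<close>-th ancestor of the parent is the next ancestor of
    \<open>v\<close>; the leader repeats itself.\<close>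
  have up: "(if parent v = v then (parent ^^ j) v else fst (snd (the (received E t v (parent v)))))
      = (parent ^^ Suc j) v"
    using parent_nbr[OF v] by (auto simp: rec iter_parent_commute iter_parent_fixed)
  have "state E (Suc t) v = advance
      (Tracing v (parent v) radius j ((parent ^^ j) v) (Abs_fset (traced j v))) (received E t v)"
    using S v by (simp add: state_Suc)
  then show ?thesis
    unfolding advance.simps Let_def dom Q up filt by simp
qed

lemma tracing_state:
  "j \<le> radius \<Longrightarrow> v \<in> V \<Longrightarrow> state E (wake + j) v =
     Tracing v (parent v) radius j ((parent ^^ j) v) (Abs_fset (traced j v))"
proof (induction j arbitrary: v)
  case 0
  then show ?case using waking_state by simp
next
  case (Suc j)
  then show ?case using tracing_step[of "wake + j" j v] by simp
qed

section \<open>The convergecast\<close>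

definition converge_time :: nat where
  "converge_time = wake + Suc radius"

lemma converging_step:
  assumes S: "\<And>v. v \<in> V \<Longrightarrow> state E t v = Converging v (parent v) radius j (subtree_key j v)"
    and v: "v \<in> V"
  shows "state E (Suc t) v =
    (if j < radius then Converging v (parent v) radius (Suc j) (subtree_key (Suc j) v)
     else Informing v (parent v) radius 0 (subtree_key (Suc j) v) {||})"
proof -
  let ?f = "\<lambda>u. (parent u, subtree_key j u)"
  have "received E t v = (\<lambda>u. if u \<in> neighbours E v then Some (broadcast (state E t u)) else None)"
    using S by (intro received_running) simp
  also have "\<dots> = (\<lambda>u. if u \<in> neighbours E v then Some (?f u) else None)"
    using S nbr_in by (auto simp: fun_eq_iff)
  finally have rec: "received E t v = \<dots>" .
  have ran: "ran (received E t v) = ?f ` neighbours E v" unfolding rec by (rule ran_restricted)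
  have "snd ` {x \<in> ran (received E t v). fst x = v} = subtree_key j ` {u \<in> neighbours E v. parent u = v}"
    unfolding ran by force
  then have g: "Min (insert (subtree_key j v) (snd ` {x \<in> ran (received E t v). fst x = v}))
      = subtree_key (Suc j) v" by simp
  have "state E (Suc t) v =
      advance (Converging v (parent v) radius j (subtree_key j v)) (received E t v)"
    using S v by (simp add: state_Suc)
  then show ?thesis
    unfolding advance.simps Let_def g .
qed

lemma converging_state:
  "j \<le> radius \<Longrightarrow> v \<in> V \<Longrightarrow> state E (converge_time + j) v =
     Converging v (parent v) radius j (subtree_key j v)"
proof (induction j arbitrary: v)
  case 0
  have "(\<lambda>u. (card (traced (Suc radius) v `` {v} \<inter> traced (Suc radius) v `` {u}), v, u)) `
             insert v {u \<in> neighbours E v. parent u \<noteq> v \<and> u \<noteq> parent v}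
      = (\<lambda>u. (card (ancestors parent v \<inter> ancestors parent u), v, u)) `
             insert v {u \<in> neighbours E v. parent u \<noteq> v \<and> u \<noteq> parent v}"
    using 0(2) nbr_in by (intro image_cong refl) (auto simp: traced_image)
  then show ?case
    using tracing_step[of "wake + radius" radius v] tracing_state 0
    by (simp add: converge_time_def key_def)
next
  case (Suc j)
  then show ?case using converging_step[of "converge_time + j" j v] by simp
qed

section \<open>Handing the chosen edges down\<close>

definition inform_time :: nat where
  "inform_time = converge_time + Suc radius"

text \<open>The tree edges also stand under \<open>i < j\<close>, so that
  \<open>informed 0 v\<close> is empty like the initial output.\<close>

definition informed :: "nat \<Rightarrow> nat \<Rightarrow> nat set" where
  "informed j v = {u \<in> neighbours E v. \<exists>i<j. u = parent v \<or> parent u = v \<or>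
     snd (best ((parent ^^ i) v)) = (v, u) \<or> snd (best ((parent ^^ i) u)) = (u, v)}"

lemma finite_informed [simp]: "finite (informed j v)"
  by (auto simp: informed_def)

lemma informing_step:
  assumes S: "\<And>v. v \<in> V \<Longrightarrow> state E t v =
      Informing v (parent v) radius j (best ((parent ^^ j) v)) (Abs_fset (informed j v))"
    and v: "v \<in> V"
  shows "state E (Suc t) v =
    (if j < radius
     then Informing v (parent v) radius (Suc j) (best ((parent ^^ Suc j) v))
        (Abs_fset (informed (Suc j) v))
     else Halted (Abs_fset (informed (Suc j) v)))"
proof -
  let ?f = "\<lambda>u. (parent u, best ((parent ^^ j) u))"
  have "received E t v = (\<lambda>u. if u \<in> neighbours E v then Some (broadcast (state E t u)) else None)"
    using S by (intro received_running) simp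
  also have "\<dots> = (\<lambda>u. if u \<in> neighbours E v then Some (?f u) else None)"
    using S nbr_in by (auto simp: fun_eq_iff)
  finally have rec: "received E t v = \<dots>" .
  have dom: "dom (received E t v) = neighbours E v" unfolding rec by (rule dom_restricted)
  have "{u \<in> neighbours E v. u = parent v \<or> fst (the (received E t v u)) = v \<or>
         snd (best ((parent ^^ j) v)) = (v, u) \<or> snd (snd (the (received E t v u))) = (u, v)}
      = {u \<in> neighbours E v. u = parent v \<or> parent u = v \<or>
         snd (best ((parent ^^ j) v)) = (v, u) \<or> snd (best ((parent ^^ j) u)) = (u, v)}"
    unfolding rec by auto
  then have F: "fset (Abs_fset (informed j v)) \<union> {u \<in> neighbours E v. u = parent v \<or>
         fst (the (received E t v u)) = v \<or>
         snd (best ((parent ^^ j) v)) = (v, u) \<or> snd (snd (the (received E t v u))) = (u, v)}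
      = informed (Suc j) v"
    by (auto simp: Abs_fset_inverse informed_def less_Suc_eq)
  have up: "(if parent v = v then best ((parent ^^ j) v) else snd (the (received E t v (parent v))))
      = best ((parent ^^ Suc j) v)"
    using parent_nbr[OF v] by (auto simp: rec iter_parent_commute iter_parent_fixed)
  have "state E (Suc t) v = advance
      (Informing v (parent v) radius j (best ((parent ^^ j) v)) (Abs_fset (informed j v)))
      (received E t v)"
    using S v by (simp add: state_Suc)
  then show ?thesis
    unfolding advance.simps Let_def dom F up by simp
qed

lemma informing_state:
  "j \<le> radius \<Longrightarrow> v \<in> V \<Longrightarrow> state E (inform_time + j) v =
     Informing v (parent v) radius j (best ((parent ^^ j) v)) (Abs_fset (informed j v))"
proof (induction j arbitrary: v)
  case 0
  have "informed 0 v = {}" by (simp add: informed_def)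
  then show ?case
    using converging_step[of "converge_time + radius" radius v] converging_state 0
    by (simp add: inform_time_def best_def bot_fset_def del: subtree_key.simps)
next
  case (Suc j)
  then show ?case using informing_step[of "inform_time + j" j v] by simp
qed

section \<open>Output, running time and message size\<close>

definition halt_time :: nat where
  "halt_time = inform_time + Suc radius"

lemma halted_state: "v \<in> V \<Longrightarrow> outcome (state E (halt_time + k) v) = Some (neighbours solution v)"
proof (induction k)
  case 0
  have "informed (Suc radius) v = neighbours solution v"
    unfolding neighbours_solution[OF 0] informed_def by (auto simp: less_Suc_eq_le)
  moreover have "fset (Abs_fset (informed (Suc radius) v)) = informed (Suc radius) v"
    by (simp add: Abs_fset_inverse)
  ultimately show ?case
    using informing_step[of "inform_time + radius" radius v] informing_state 0
    by (simp add: halt_time_def)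
next
  case (Suc k)
  then show ?case by (simp add: state_Suc)
qed

text \<open>With diameter \<open>D\<close>, the flooding takes at most \<open>3 * D + 2\<close>
  rounds and each of the three phases at most \<open>D + 1\<close>, in total
  \<open>6 * D + 5\<close>; \<open>D \<ge> 1\<close> absorbs the constant.\<close>

lemma halt_time_le: "halt_time \<le> 11 * graph_diameter V E"
  using wake_le radius_le diameter_pos[OF nontrivial]
  unfolding halt_time_def inform_time_def converge_time_def by linarith

lemma stage_cases:
  obtains "t < wake" | j where "j \<le> radius" "t = wake + j"
    | j where "j \<le> radius" "t = converge_time + j"
    | j where "j \<le> radius" "t = inform_time + j"
    | j where "t = halt_time + j"
proof -
  consider "t < wake" | "wake \<le> t" "t < converge_time" | "converge_time \<le> t" "t < inform_time"
    | "inform_time \<le> t" "t < halt_time" | "halt_time \<le> t" by linarith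
  then show ?thesis
  proof cases
    case 2
    then show ?thesis using that(2)[of "t - wake"] by (simp add: converge_time_def)
  next
    case 3
    then show ?thesis using that(3)[of "t - converge_time"] by (simp add: inform_time_def)
  next
    case 4
    then show ?thesis using that(4)[of "t - inform_time"] by (simp add: halt_time_def)
  next
    case 5
    then show ?thesis using that(5)[of "t - halt_time"] by simp
  qed (use that in blast)
qed

text \<open>In every phase the entries are identifiers, distances, counts of ancestors or 0;
  \<open>card V ^ 2\<close> bounds the distances and the counts.\<close>

lemma broadcast_bounded:
  assumes ids: "\<And>v. v \<in> V \<Longrightarrow> v < B" and B: "card V ^ 2 < B"
    and v: "v \<in> V" and running: "outcome (state E t v) = None"
    and b: "broadcast (state E t v) = (q, l, d, z)"
  shows "q < B \<and> l < B \<and> d < B \<and> z < B"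
proof -
  have dist: "graph_dist E x y < B" if "x \<in> V" "y \<in> V" for x y
    using dist_le_card_square[OF that] B by simp
  have card: "card (ancestors parent x \<inter> ancestors parent y) < B" if "x \<in> V" for x y
  proof -
    have "card (ancestors parent x \<inter> ancestors parent y) \<le> card V"
      using tree.ancestors_subset[OF that] finV by (intro card_mono) auto
    also have "\<dots> \<le> card V ^ 2" by (simp add: power2_eq_square)
    finally show ?thesis using B by simp
  qed
  have key: "fst (key w) < B \<and> fst (snd (key w)) < B \<and> snd (snd (key w)) < B" if w: "w \<in> V" for w
  proof -
    obtain u where "u = w \<or> u \<in> neighbours E w"
      "key w = (card (ancestors parent w \<inter> ancestors parent u), w, u)" using key_cases by metis
    then show ?thesis using card[OF w] ids nbr_in w by auto
  qed
  have sub: "fst (subtree_key j w) < B \<and> fst (snd (subtree_key j w)) < B \<and>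
      snd (snd (subtree_key j w)) < B" if "w \<in> V" for j w
    using subtree_key_in[OF that, of j] key by metis
  have "0 < B" using B by simp
  show ?thesis
  proof (cases rule: stage_cases[of t])
    case 1
    obtain x y where "x \<in> V" "y \<in> V" "far E t v = graph_dist E x y"
      using far_le_dist[OF v] .
    then have "far E t v < B" using dist by simp
    moreover have "fst (flood E t v) < B" "snd (flood E t v) < B"
      using flood_walk[OF v, of t] flood_dist[OF v, of t] ids dist v by auto
    ultimately show ?thesis using flooding_state[OF 1 v] b \<open>0 < B\<close> by auto
  next
    case (2 j)
    then show ?thesis using tracing_state[OF 2(1) v] b \<open>0 < B\<close> ids v
        tree.parent_in tree.iter_parent_in by auto
  next
    case (3 j)
    then show ?thesis using converging_state[OF 3(1) v] b ids v tree.parent_in sub[OF v, of j] by auto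
  next
    case (4 j)
    then show ?thesis using informing_state[OF 4(1) v] b ids v tree.parent_in
        sub[OF tree.iter_parent_in[OF v, of j], of "Suc radius"] by (auto simp: best_def simp del: subtree_key.simps)
  next
    case (5 j)
    then show ?thesis using halted_state[OF v] running by simp
  qed
qed

lemma bandwidth:
  assumes ids: "\<And>v. v \<in> V \<Longrightarrow> v < card V ^ c"
  shows "bandwidth_at_most ecss_algorithm E (real (8 * (c + 3) + 15) * log 2 (card V))"
  unfolding bandwidth_at_most_def
proof (intro allI impI)
  fix t u v m
  assume "message ecss_algorithm E (run ecss_algorithm E t) u v = Some m"
  then have u: "u \<in> neighbours E v" "outcome (state E t u) = None"
    and m: "m = encode (broadcast (state E t u))"
    unfolding message_run by (auto simp: received_def split: if_splits)
  obtain q l d z where b: "broadcast (state E t u) = (q, l, d, z)" using prod_cases4 by blast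
  \<comment> \<open>The exponent is at least \<open>c\<close> for the identifiers and exceeds 2 to
    dominate \<open>card V ^ 2\<close> strictly.\<close>
  have "v' < card V ^ (c + 3)" if "v' \<in> V" for v'
    using ids[OF that] nontrivial by (meson le_add1 less_le_trans one_le_numeral order_trans power_increasing)
  moreover have "card V ^ 2 < card V ^ (c + 3)" using nontrivial by (intro power_strict_increasing) auto
  ultimately have "q < card V ^ (c + 3) \<and> l < card V ^ (c + 3) \<and> d < card V ^ (c + 3) \<and>
      z < card V ^ (c + 3)"
    using broadcast_bounded[OF _ _ nbr_in[OF u(1)] u(2) b] by blast
  then show "real (length m) \<le> real (8 * (c + 3) + 15) * log 2 (card V)"
    using length_encode[of q "card V" "c + 3" l d z] nontrivial by (simp add: m b)
qed

end

lemma singleton_network: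
  assumes "simple_graph V E" "card V \<le> 1"
  shows "E = {}"
proof (rule ccontr)
  assume "E \<noteq> {}"
  then obtain e where "e \<subseteq> V" "card e = 2" using assms(1) unfolding simple_graph_def by blast
  moreover have "finite V" using assms(1) by (simp add: simple_graph_def)
  ultimately show False using assms(2) card_mono[of V e] by simp
qed

theorem theorem3:
  fixes c :: nat
  shows "\<exists>(A :: nat congest_algorithm) (b :: real) (C :: real).
    \<forall>V E. congest_network c V E \<and> two_edge_connected V E \<longrightarrow>
      bandwidth_at_most A E (b * log 2 (real (card V))) \<and>
      (\<exists>T H. real T \<le> C * real (graph_diameter V E) \<and>
             computes_edges_within A V E T H \<and> two_approx_2ecss V E H)"
proof (intro exI allI impI)
  fix V :: "nat set" and E :: "nat set set"
  assume "congest_network c V E \<and> two_edge_connected V E"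
  then have graph: "simple_graph V E" and conn: "graph_connected V E"
    and ids: "\<And>v. v \<in> V \<Longrightarrow> v < card V ^ c" and two: "two_edge_connected V E"
    by (auto simp: congest_network_def)
  \<comment> \<open>Proving this instance fixes the witnesses: \<open>b\<close> comes from
    \<open>bandwidth\<close> and \<open>C = 11\<close> from \<open>halt_time_le\<close>.\<close>
  let ?goal = "bandwidth_at_most ecss_algorithm E (real (8 * (c + 3) + 15) * log 2 (real (card V))) \<and>
      (\<exists>T H. real T \<le> 11 * real (graph_diameter V E) \<and>
             computes_edges_within ecss_algorithm V E T H \<and> two_approx_2ecss V E H)"
  show ?goal
  proof (cases "card V \<ge> 2")
    case True
    then interpret nontrivial_network V E using graph conn by unfold_locales
    have "real halt_time \<le> 11 * real (graph_diameter V E)" using halt_time_le by linarith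
    moreover have "computes_edges_within ecss_algorithm V E halt_time solution"
      using halted_state[of _ 0] by (simp add: computes_edges_within_def result_run)
    ultimately show ?thesis
      using bandwidth[OF ids] solution_two_approx[OF two True] by blast
  next
    case False
    \<comment> \<open>For one vertex both the diameter and the bandwidth bound are 0; it has halted
      from the start and sends nothing.\<close>
    then have E: "E = {}" using singleton_network[OF graph] by simp
    have "bandwidth_at_most ecss_algorithm E (real (8 * (c + 3) + 15) * log 2 (real (card V)))"
      by (simp add: bandwidth_at_most_def message_def E)
    moreover have "computes_edges_within ecss_algorithm V E 0 {}"
      by (simp add: computes_edges_within_def result_run state_0 neighbours_def E del: run.simps)
    moreover have "two_approx_2ecss V E {}"
      using two E by (simp add: two_approx_2ecss_def is_2ecss_def)
    ultimately show ?thesis by (intro conjI exI[of _ 0] exI[of _ "{}"]) auto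
  qed
qed

end
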